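(* Suppose $R:[0,\infty)\to[0,\infty)$ is measurable, nondecreasing, strictly concave, $R(0)=0$, twice continuously differentiable on $(0,\infty)$, with derivative $R_c$ satisfying $\lim_{C\to0}R_c(C)=\infty$ and $\lim_{C\to\infty}R_c(C)=0$; and suppose $G(C)=G_0+\frac{c_-}{f_C}C$ for some $G_0\ge0$. Then for every $t\in[0,T)$ there exist $0\le\hat y_+(t)<\hat y_-(t)\le\infty$ such that $$\mathcal C_t=(\hat y_+(t),\hat y_-(t)),\qquad \mathcal S_{+,t}=(0,\hat y_+(t)],\qquad \mathcal S_{-,t}=[\hat y_-(t),\infty).$$
   Context: Constants: $T>0$, $\mu_C,\sigma_C,f_C,\mu_F>0$, $c_+>c_->0$; $\bar\mu:=\mu_C+\mu_F$, $\hat\mu_C:=-\mu_C+\frac12\sigma_C^2$. $(\Omega,\mathcal F,\mathbb P)$ is a complete probability space with a Brownian motion $W$ and its augmented natural filtration $\mathbb F=\{\mathcal F_t\}$. The measure $\tilde{\mathbb P}$ (expectation $\tilde{\mathbb E}$) is defined by $d\tilde{\mathbb P}/d\mathbb P|_{\mathcal F_t}=\exp\{-\frac12\sigma_C^2t+\sigma_CW(t)\}$, so $\tilde W(t)=W(t)-\sigma_Ct$ is a $\tilde{\mathbb P}$-Brownian motion, and $C^0(t)=\exp\{\hat\mu_Ct+\sigma_C\tilde W(t)\}$. For $(t,y)\in[0,T]\times(0,\infty)$ and $\mathbb F$-stopping times $\sigma,\tau$ with values in $[0,T-t]$ set $$\Psi(t,y;\sigma,\tau)=\tilde{\mathbb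 E}\Big\{\tfrac{c_+}{f_C}e^{-\bar\mu\sigma}\mathbf 1_{\{\sigma\le\tau\}}\mathbf 1_{\{\sigma<T-t\}}+\tfrac{c_-}{f_C}e^{-\bar\mu\tau}\mathbf 1_{\{\tau<\sigma\}}+e^{-\bar\mu(T-t)}G_c(yC^0(T-t))\mathbf 1_{\{\tau=\sigma=T-t\}}+\int_0^{\tau\wedge\sigma}e^{-\bar\mu s}R_c(yC^0(s))ds\Big\},$$ where $G_c=G'$ (here $G_c\equiv c_-/f_C$). The value of the game is $$v(t,y)=\inf_{\sigma\in[0,T-t]}\sup_{\tau\in[0,T-t]}\Psi(t,y;\sigma,\tau)=\sup_{\tau\in[0,T-t]}\inf_{\sigma\in[0,T-t]}\Psi(t,y;\sigma,\tau)$$ (the game has a value). One has $c_-/f_C\le v\le c_+/f_C$. For fixed $t$: $\mathcal C_t:=\{y\in(0,\infty):\frac{c_-}{f_C}<v(t,y)<\frac{c_+}{f_C}\}$ and $\mathcal S_{\pm,t}:=\{y\in(0,\infty):v(t,y)=\frac{c_\pm}{f_C}\}$. If an endpoint is $0$ (resp. $\infty$), the set $(0,\hat y_+(t)]$ (resp. $[\hat y_-(t),\infty)$) is understood to be empty. *)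

theory Defs
  imports "HOL-Probability.Probability"
begin

section \<open>The probabilistic setting\<close>

locale brownian_motion = prob_space M
  for M :: "'a measure" and W :: "real \<Rightarrow> 'a \<Rightarrow> real" +
  assumes random_variable_W: "\<And>t. 0 \<le> t \<Longrightarrow> random_variable borel (W t)"
    and W_zero: "AE \<omega> in M. W 0 \<omega> = 0"
    and gaussian_increments: "\<And>s t. 0 \<le> s \<Longrightarrow> s < t \<Longrightarrow>
      distributed M lborel (\<lambda>\<omega>. W t \<omega> - W s \<omega>) (normal_density 0 (sqrt (t - s)))"
    and indep_increments: "\<And>(n::nat) (u :: nat \<Rightarrow> real). 0 \<le> u 0 \<Longrightarrow> strict_mono u \<Longrightarrow>
      indep_vars (\<lambda>_. borel) (\<lambda>i \<omega>. W (u (Suc i)) \<omega> - W (u i) \<omega>) {..<n}"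
    and continuous_paths: "AE \<omega> in M. continuous_on {0..} (\<lambda>t. W t \<omega>)"

text \<open>
  For \<open>t < 0\<close> the following \<open>\<sigma>\<close>-algebra is generated by the null sets alone; these indices occur
  in \<^const>\<open>stopping_time\<close>, but are irrelevant for nonnegative stopping times.
\<close>

definition aug_filtration :: "'a measure \<Rightarrow> (real \<Rightarrow> 'a \<Rightarrow> real) \<Rightarrow> real \<Rightarrow> 'a measure" where
  "aug_filtration M W t =
     sigma (space M) ((\<Union>s\<in>{0..t}. {W s -` B \<inter> space M | B. B \<in> sets borel}) \<union> null_sets M)"

definition stopping_times :: "'a measure \<Rightarrow> (real \<Rightarrow> 'a \<Rightarrow> real) \<Rightarrow> real \<Rightarrow> ('a \<Rightarrow> real) set" where
  "stopping_times M W h =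
     {\<tau>. stopping_time (aug_filtration M W) \<tau> \<and> (\<forall>\<omega>\<in>space M. 0 \<le> \<tau> \<omega> \<and> \<tau> \<omega> \<le> h)}"

text \<open>
  \<open>Q\<close> is the measure with \<open>dQ/dM = exp (- \<sigma>\<^sub>C\<^sup>2 t / 2 + \<sigma>\<^sub>C W(t))\<close> on the \<open>\<sigma>\<close>-algebra of time \<open>t\<close>,
  for every \<open>t\<close> up to the horizon \<open>T\<close>.
\<close>

definition tilted_measure ::
    "real \<Rightarrow> real \<Rightarrow> 'a measure \<Rightarrow> (real \<Rightarrow> 'a \<Rightarrow> real) \<Rightarrow> 'a measure \<Rightarrow> bool" where
  "tilted_measure T \<sigma>\<^sub>C M W Q \<longleftrightarrow>
     sets Q = sets M \<and>
     (\<forall>t\<in>{0..T}.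
        restr_to_subalg Q (aug_filtration M W t) =
        density (restr_to_subalg M (aug_filtration M W t))
          (\<lambda>\<omega>. ennreal (exp (- (1/2) * \<sigma>\<^sub>C\<^sup>2 * t + \<sigma>\<^sub>C * W t \<omega>))))"

definition tilted_bm :: "real \<Rightarrow> (real \<Rightarrow> 'a \<Rightarrow> real) \<Rightarrow> real \<Rightarrow> 'a \<Rightarrow> real" where
  "tilted_bm \<sigma>\<^sub>C W t \<omega> = W t \<omega> - \<sigma>\<^sub>C * t"

definition C0_process ::
    "real \<Rightarrow> real \<Rightarrow> (real \<Rightarrow> 'a \<Rightarrow> real) \<Rightarrow> real \<Rightarrow> 'a \<Rightarrow> real" where
  "C0_process \<mu>\<^sub>C \<sigma>\<^sub>C W t \<omega> =
     exp ((- \<mu>\<^sub>C + (1/2) * \<sigma>\<^sub>C\<^sup>2) * t + \<sigma>\<^sub>C * tilted_bm \<sigma>\<^sub>C W t \<omega>)"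


section \<open>The stopping game\<close>

text \<open>
  In the following definitions \<open>Q\<close> is the tilted measure, \<open>r\<close> is the discount rate
  \<open>\<mu>\<^sub>C + \<mu>\<^sub>F\<close>, \<open>X\<close> is the process \<^const>\<open>C0_process\<close>, and \<open>Rc\<close>, \<open>Gc\<close> are the
  derivatives of \<open>R\<close>, \<open>G\<close>; only their values on \<open>(0,\<infinity>)\<close> matter.
\<close>

definition game_payoff ::
    "'a measure \<Rightarrow> real \<Rightarrow> real \<Rightarrow> real \<Rightarrow> real \<Rightarrow> real \<Rightarrow> (real \<Rightarrow> 'a \<Rightarrow> real) \<Rightarrow>
     (real \<Rightarrow> real) \<Rightarrow> (real \<Rightarrow> real) \<Rightarrow> real \<Rightarrow> real \<Rightarrow> ('a \<Rightarrow> real) \<Rightarrow> ('a \<Rightarrow> real) \<Rightarrow> real" where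
  "game_payoff Q T f\<^sub>C c\<^sub>p c\<^sub>m r X Rc Gc t y \<sigma> \<tau> =
     (\<integral>\<omega>. c\<^sub>p / f\<^sub>C * exp (- r * \<sigma> \<omega>) * of_bool (\<sigma> \<omega> \<le> \<tau> \<omega>) * of_bool (\<sigma> \<omega> < T - t)
        + c\<^sub>m / f\<^sub>C * exp (- r * \<tau> \<omega>) * of_bool (\<tau> \<omega> < \<sigma> \<omega>)
        + exp (- r * (T - t)) * Gc (y * X (T - t) \<omega>) * of_bool (\<tau> \<omega> = T - t \<and> \<sigma> \<omega> = T - t)
        + (LBINT s:{0..min (\<tau> \<omega>) (\<sigma> \<omega>)}. exp (- r * s) * Rc (y * X s \<omega>)) \<partial>Q)"

text \<open>
  The value is written as \<open>inf\<^sub>\<sigma> sup\<^sub>\<tau>\<close>; since the game has a value, this is also \<open>sup\<^sub>\<tau> inf\<^sub>\<sigma>\<close>.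
\<close>

definition game_value ::
    "'a measure \<Rightarrow> (real \<Rightarrow> 'a \<Rightarrow> real) \<Rightarrow> 'a measure \<Rightarrow>
     real \<Rightarrow> real \<Rightarrow> real \<Rightarrow> real \<Rightarrow> real \<Rightarrow> (real \<Rightarrow> 'a \<Rightarrow> real) \<Rightarrow>
     (real \<Rightarrow> real) \<Rightarrow> (real \<Rightarrow> real) \<Rightarrow> real \<Rightarrow> real \<Rightarrow> real" where
  "game_value M W Q T f\<^sub>C c\<^sub>p c\<^sub>m r X Rc Gc t y =
     (INF \<sigma>\<in>stopping_times M W (T - t). SUP \<tau>\<in>stopping_times M W (T - t).
        game_payoff Q T f\<^sub>C c\<^sub>p c\<^sub>m r X Rc Gc t y \<sigma> \<tau>)"

definition continuation_set ::
    "(real \<Rightarrow> real \<Rightarrow> real) \<Rightarrow> real \<Rightarrow> real \<Rightarrow> real \<Rightarrow> real \<Rightarrow> real set" where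
  "continuation_set v f\<^sub>C c\<^sub>p c\<^sub>m t = {y\<in>{0<..}. c\<^sub>m / f\<^sub>C < v t y \<and> v t y < c\<^sub>p / f\<^sub>C}"

definition stopping_set :: "(real \<Rightarrow> real \<Rightarrow> real) \<Rightarrow> real \<Rightarrow> real \<Rightarrow> real \<Rightarrow> real set" where
  "stopping_set v f\<^sub>C c t = {y\<in>{0<..}. v t y = c / f\<^sub>C}"


section \<open>Strict concavity\<close>

definition strictly_concave_on :: "real set \<Rightarrow> (real \<Rightarrow> real) \<Rightarrow> bool" where
  "strictly_concave_on S f \<longleftrightarrow>
     convex S \<and>
     (\<forall>x\<in>S. \<forall>y\<in>S. \<forall>u. x \<noteq> y \<and> 0 < u \<and> u < 1 \<longrightarrow>
        (1 - u) * f x + u * f y < f ((1 - u) * x + u * y))"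

end

theory Submission
  imports Defs "HOL-Real_Asymp.Real_Asymp"
begin

text \<open>
  Write \<open>h = T - t\<close>. The state \<open>y\<close> enters the payoff only through the running reward: the final
  payment is the constant \<open>c\<^sub>m / f\<^sub>C\<close>, because \<open>G\<close> is affine. The thresholds therefore follow from
  properties of the expected running reward \<open>\<Phi> y\<close> over the full horizon.

  As \<open>Rc\<close> is antitone, for \<open>y1 \<le> y2\<close> and any pair of stopping times the payoff at \<open>y1\<close> exceeds that at
  \<open>y2\<close> by an amount between \<open>0\<close> and \<open>\<Phi> y1 - \<Phi> y2\<close> (\<open>payoff_diff\<close>). These bounds are uniform in the
  strategies and pass to the infimum of suprema (\<open>inf_sup_le_add\<close>). Hence the value is antitone in
  \<open>y\<close>, and it is continuous because \<open>\<Phi>\<close> is, by dominated convergence. Immediate stopping of either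
  player confines the value to \<open>[c\<^sub>m / f\<^sub>C, c\<^sub>p / f\<^sub>C]\<close>. The two sets where an endpoint is attained are thus
  relatively closed half-lines (\<open>antitone_continuous_thresholds\<close>).

  The thresholds differ because the value is not constantly equal to an endpoint. It is below
  \<open>c\<^sub>p / f\<^sub>C\<close> for large \<open>y\<close>: if the minimiser never stops, it is at most \<open>c\<^sub>m / f\<^sub>C + \<Phi> y\<close>, and \<open>\<Phi>\<close> vanishes at
  infinity since \<open>Rc\<close> does (\<open>val_not_upper\<close>). It is above \<open>c\<^sub>m / f\<^sub>C\<close> for small \<open>y\<close>: if the maximiser never
  stops, the minimiser either stops so early that the payment is close to \<open>c\<^sub>p / f\<^sub>C\<close>, or lets a reward
  accumulate that explodes as \<open>y\<close> tends to \<open>0\<close> (\<open>val_not_lower\<close>).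

  All this needs \<open>\<Phi>\<close> to be finite although \<open>Rc\<close> is unbounded near \<open>0\<close>. Concavity gives
  \<open>Rc x \<le> R x / x\<close>, hence \<open>Rc x \<le> Rc 1 + R 1 / x\<close>, and under the tilted measure the inverse of the process
  at time \<open>s\<close> has expectation \<open>exp (\<mu>\<^sub>C s)\<close> (\<open>C0_process_inverse_moment\<close>).
\<close>

section \<open>Comparison of infima of suprema\<close>

definition inf_sup :: "'s set \<Rightarrow> ('s \<Rightarrow> 's \<Rightarrow> real) \<Rightarrow> real" where
  "inf_sup S f = (INF \<sigma>\<in>S. SUP \<tau>\<in>S. f \<sigma> \<tau>)"

lemma inf_sup_ge:
  assumes S: "S \<noteq> {}"
    and ub: "\<And>\<sigma> \<tau>. \<sigma> \<in> S \<Longrightarrow> \<tau> \<in> S \<Longrightarrow> f \<sigma> \<tau> \<le> K"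
    and \<tau>: "\<tau> \<in> S" and lb: "\<And>\<sigma>. \<sigma> \<in> S \<Longrightarrow> c \<le> f \<sigma> \<tau>"
  shows "c \<le> inf_sup S f"
  unfolding inf_sup_def
proof (rule cINF_greatest[OF S])
  fix \<sigma> assume \<sigma>: "\<sigma> \<in> S"
  have "bdd_above (f \<sigma> ` S)" using ub[OF \<sigma>] by (intro bdd_aboveI2[of _ _ K])
  then show "c \<le> (SUP \<tau>\<in>S. f \<sigma> \<tau>)"
    using lb[OF \<sigma>] cSUP_upper[OF \<tau>, of "f \<sigma>"] by linarith
qed

lemma inf_sup_bdd_below:
  fixes f :: "'s \<Rightarrow> 's \<Rightarrow> real"
  assumes lb: "\<And>\<sigma> \<tau>. \<sigma> \<in> S \<Longrightarrow> \<tau> \<in> S \<Longrightarrow> k \<le> f \<sigma> \<tau>"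
    and ub: "\<And>\<sigma> \<tau>. \<sigma> \<in> S \<Longrightarrow> \<tau> \<in> S \<Longrightarrow> f \<sigma> \<tau> \<le> K"
  shows "bdd_below ((\<lambda>\<sigma>. SUP \<tau>\<in>S. f \<sigma> \<tau>) ` S)"
proof (rule bdd_belowI2[of _ k])
  fix \<sigma> assume \<sigma>: "\<sigma> \<in> S"
  have "bdd_above (f \<sigma> ` S)" using ub[OF \<sigma>] by (intro bdd_aboveI2[of _ _ K])
  then show "k \<le> (SUP \<tau>\<in>S. f \<sigma> \<tau>)"
    using lb[OF \<sigma> \<sigma>] cSUP_upper[OF \<sigma>, of "f \<sigma>"] by linarith
qed

lemma inf_sup_le:
  assumes lb: "\<And>\<sigma> \<tau>. \<sigma> \<in> S \<Longrightarrow> \<tau> \<in> S \<Longrightarrow> k \<le> f \<sigma> \<tau>"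
    and ub: "\<And>\<sigma> \<tau>. \<sigma> \<in> S \<Longrightarrow> \<tau> \<in> S \<Longrightarrow> f \<sigma> \<tau> \<le> K"
    and \<sigma>: "\<sigma> \<in> S" and le: "\<And>\<tau>. \<tau> \<in> S \<Longrightarrow> f \<sigma> \<tau> \<le> c"
  shows "inf_sup S f \<le> c"
  unfolding inf_sup_def
proof (rule cINF_lower2[OF inf_sup_bdd_below[OF lb ub] \<sigma>])
  show "(SUP \<tau>\<in>S. f \<sigma> \<tau>) \<le> c" using \<sigma> le by (intro cSUP_least) auto
qed auto

text \<open>
  A uniform bound on the difference of two payoffs passes to the values, whether or not optimal
  strategies exist. With \<open>d = 0\<close> this transports monotonicity, with \<open>d > 0\<close> it transports continuity.
\<close>

lemma inf_sup_le_add: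
  assumes S: "S \<noteq> {}"
    and lb: "\<And>\<sigma> \<tau>. \<sigma> \<in> S \<Longrightarrow> \<tau> \<in> S \<Longrightarrow> k \<le> f \<sigma> \<tau>"
    and ub: "\<And>\<sigma> \<tau>. \<sigma> \<in> S \<Longrightarrow> \<tau> \<in> S \<Longrightarrow> g \<sigma> \<tau> \<le> K"
    and le: "\<And>\<sigma> \<tau>. \<sigma> \<in> S \<Longrightarrow> \<tau> \<in> S \<Longrightarrow> f \<sigma> \<tau> \<le> g \<sigma> \<tau> + d"
  shows "inf_sup S f \<le> inf_sup S g + d"
proof -
  have fub: "f \<sigma> \<tau> \<le> K + d" if "\<sigma> \<in> S" "\<tau> \<in> S" for \<sigma> \<tau>
    using le[OF that] ub[OF that] by simp
  have "inf_sup S f - d \<le> inf_sup S g"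
    unfolding inf_sup_def[of S g]
  proof (rule cINF_greatest[OF S])
    fix \<sigma> assume \<sigma>: "\<sigma> \<in> S"
    have bdd: "bdd_above (g \<sigma> ` S)" using ub[OF \<sigma>] by (intro bdd_aboveI2[of _ _ K])
    have "inf_sup S f \<le> (SUP \<tau>\<in>S. g \<sigma> \<tau>) + d"
    proof (rule inf_sup_le[OF lb fub \<sigma>])
      fix \<tau> assume \<tau>: "\<tau> \<in> S"
      show "f \<sigma> \<tau> \<le> (SUP \<tau>\<in>S. g \<sigma> \<tau>) + d"
        using le[OF \<sigma> \<tau>] cSUP_upper[OF \<tau> bdd] by simp
    qed
    then show "inf_sup S f - d \<le> (SUP \<tau>\<in>S. g \<sigma> \<tau>)" by simp
  qed
  then show ?thesis by simp
qed

section \<open>Level sets of antitone continuous functions\<close>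

text \<open>
  Antitonicity makes the level set of the maximum \<open>b\<close> a down-set and that of the minimum \<open>a\<close> an
  up-set; continuity makes both relatively closed in the positive half-line and keeps them from
  touching. The last two hypotheses are what separates the thresholds when one of the two sets is
  empty: without them \<open>p = q = 0\<close> or \<open>p = q = \<infinity>\<close> could occur.
\<close>

lemma antitone_continuous_thresholds:
  fixes w :: "real \<Rightarrow> real"
  assumes "a < b"
    and cont: "continuous_on {0<..} w"
    and anti: "\<And>x y. 0 < x \<Longrightarrow> x \<le> y \<Longrightarrow> w y \<le> w x"
    and lower: "\<And>y. 0 < y \<Longrightarrow> a \<le> w y" and upper: "\<And>y. 0 < y \<Longrightarrow> w y \<le> b"
    and not_a: "\<exists>y>0. a < w y" and not_b: "\<exists>y>0. w y < b"
  shows "\<exists>p q :: ereal. 0 \<le> p \<and> p < q \<and> q \<le> \<infinity> \<and>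
    {y\<in>{0<..}. a < w y \<and> w y < b} = {y. p < ereal y \<and> ereal y < q} \<and>
    {y\<in>{0<..}. w y = b} = {y. 0 < y \<and> ereal y \<le> p} \<and>
    {y\<in>{0<..}. w y = a} = {y. 0 < y \<and> q \<le> ereal y}"
proof -
  \<comment> \<open>The inserted \<open>0\<close> is the threshold of an empty level set; for \<open>q\<close> the infimum \<open>\<infinity>\<close> of the empty set serves.\<close>
  define p where "p = Sup (insert 0 (ereal ` {y. 0 < y \<and> w y = b}))"
  define q where "q = Inf (ereal ` {y. 0 < y \<and> w y = a})"
  have w_at: "(w \<longlongrightarrow> w y) (at y)" if "0 < y" for y
    using cont that by (simp add: continuous_on_eq_continuous_at isCont_def)
  have b_iff: "w y = b \<longleftrightarrow> ereal y \<le> p" if y: "0 < y" for y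
  proof
    assume "w y = b" then show "ereal y \<le> p"
      unfolding p_def using y by (intro Sup_upper) auto
  next
    assume yp: "ereal y \<le> p"
    have "w z = b" if z: "0 < z" "z < y" for z
    proof -
      have "ereal z < p" using z yp by (intro less_le_trans[OF _ yp]) simp
      then have "\<exists>e\<in>insert 0 (ereal ` {y. 0 < y \<and> w y = b}). ereal z < e"
        unfolding p_def by (rule less_Sup_iff[THEN iffD1])
      then obtain s where "0 < s" "w s = b" "z < s"
        using z(1) by auto
      with anti[of z s] upper[of z] z show ?thesis by simp
    qed
    then have "\<forall>\<^sub>F z in at_left y. w z = b"
      using y by (auto simp: eventually_at_left_field intro!: exI[of _ 0])
    moreover have "(w \<longlongrightarrow> w y) (at_left y)"
      using w_at[OF y] by (simp add: filterlim_at_split)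
    ultimately have "((\<lambda>_. b) \<longlongrightarrow> w y) (at_left y)"
      by (simp add: tendsto_cong)
    then show "w y = b"
      by (simp add: tendsto_const_iff)
  qed
  have a_iff: "w y = a \<longleftrightarrow> q \<le> ereal y" if y: "0 < y" for y
  proof
    assume "w y = a" then show "q \<le> ereal y"
      unfolding q_def using y by (intro Inf_lower) auto
  next
    assume yq: "q \<le> ereal y"
    have "w z = a" if z: "y < z" for z
    proof -
      have "q < ereal z" using z by (intro le_less_trans[OF yq]) simp
      then have "\<exists>e\<in>ereal ` {y. 0 < y \<and> w y = a}. e < ereal z"
        unfolding q_def by (rule Inf_less_iff[THEN iffD1])
      then obtain s where "0 < s" "w s = a" "s < z" by auto
      with anti[of s z] lower[of z] y z show ?thesis by simp
    qed
    then have "\<forall>\<^sub>F z in at_right y. w z = a"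
      by (auto simp: eventually_at_right_field intro!: exI[of _ "y + 1"])
    moreover have "(w \<longlongrightarrow> w y) (at_right y)"
      using w_at[OF y] by (simp add: filterlim_at_split)
    ultimately have "((\<lambda>_. a) \<longlongrightarrow> w y) (at_right y)"
      by (simp add: tendsto_cong)
    then show "w y = a"
      by (simp add: tendsto_const_iff)
  qed
  have p0: "0 \<le> p" unfolding p_def by (intro Sup_upper) auto
  have "p < q"
  proof (rule ccontr)
    assume "\<not> p < q"
    then have qp: "q \<le> p" by simp
    obtain y1 where y1: "0 < y1" "a < w y1" using not_a by blast
    obtain y2 where y2: "0 < y2" "w y2 < b" using not_b by blast
    have 1: "ereal y1 < q" using a_iff[of y1] y1 by auto
    have 2: "p < ereal y2" using b_iff[of y2] y2 by auto
    then obtain x where x: "p = ereal x"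
      using p0 by (cases p) auto
    have "ereal y1 < ereal x" using 1 qp unfolding x by (rule less_le_trans)
    then have "0 < x" using y1 by simp
    then have "w x = b" "w x = a" using b_iff[of x] a_iff[of x] qp x by auto
    with \<open>a < b\<close> show False by simp
  qed
  moreover have "{y\<in>{0<..}. a < w y \<and> w y < b} = {y. p < ereal y \<and> ereal y < q}"
  proof (intro set_eqI iffI)
    fix y assume "y \<in> {y\<in>{0<..}. a < w y \<and> w y < b}"
    then show "y \<in> {y. p < ereal y \<and> ereal y < q}"
      using a_iff[of y] b_iff[of y] by (auto simp: not_le[symmetric])
  next
    fix y assume y: "y \<in> {y. p < ereal y \<and> ereal y < q}"
    then have "0 < ereal y" using le_less_trans[OF p0, of "ereal y"] by simp
    then have "0 < y" by simp
    with y a_iff[of y] b_iff[of y] lower[of y] upper[of y]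
    show "y \<in> {y\<in>{0<..}. a < w y \<and> w y < b}"
      by (auto simp: not_le[symmetric] less_le)
  qed
  ultimately show ?thesis
    using p0 a_iff b_iff by (intro exI[of _ p] exI[of _ q]) auto
qed

section \<open>Derivatives of concave functions\<close>

text \<open>
  Both facts come from a concave function lying below its tangents: antitonicity compares the
  tangents at two points, the bound by the average evaluates the tangent at \<open>x\<close> in the origin.
  The second fact limits the singularity of the derivative at \<open>0\<close> to the order \<open>1 / x\<close>.
\<close>

lemma concave_marginal:
  fixes R Rc :: "real \<Rightarrow> real"
  assumes conc: "concave_on {0..} R" and R0: "R 0 = 0"
    and der: "\<And>C. 0 < C \<Longrightarrow> (R has_real_derivative Rc C) (at C)"
  shows concave_marginal_antitone: "\<And>x y. 0 < x \<Longrightarrow> x \<le> y \<Longrightarrow> Rc y \<le> Rc x"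
    and concave_marginal_le_average: "\<And>x. 0 < x \<Longrightarrow> Rc x \<le> R x / x"
proof -
  have tangent: "R x - R c \<le> Rc c * (x - c)" if "0 < c" "0 \<le> x" for x c
  proof -
    have "((\<lambda>x. - R x) has_real_derivative - Rc c) (at c within {0..})"
      using DERIV_minus[OF der[OF that(1)]] by (rule has_field_derivative_at_within)
    then have "- R x - - R c \<ge> - Rc c * (x - c)"
      using conc that unfolding concave_on_def
      by (intro convex_on_imp_above_tangent[of "{0..}"]) auto
    then show ?thesis by simp
  qed
  show "Rc y \<le> Rc x" if "0 < x" "x \<le> y" for x y
  proof (cases "x = y")
    case False
    have "Rc y * (y - x) \<le> Rc x * (y - x)"
      using tangent[of x y] tangent[of y x] that by (simp add: algebra_simps)
    then show ?thesis using that False by simp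
  qed simp
  show "Rc x \<le> R x / x" if "0 < x" for x
    using tangent[of x 0] that R0 by (simp add: field_simps)
qed

section \<open>Measurability of processes\<close>

text \<open>
  The process is the pointwise limit of its discretisations at the times \<open>\<lfloor>(n + 1) s\<rfloor> / (n + 1)\<close>,
  each of which involves only countably many random variables.
\<close>

lemma borel_measurable_pair_continuous_paths:
  fixes Y :: "real \<Rightarrow> 'a \<Rightarrow> real"
  assumes meas: "\<And>s. Y s \<in> borel_measurable M"
    and cont: "\<And>\<omega>. \<omega> \<in> space M \<Longrightarrow> continuous_on UNIV (\<lambda>s. Y s \<omega>)"
  shows "(\<lambda>(\<omega>, s). Y s \<omega>) \<in> borel_measurable (M \<Otimes>\<^sub>M borel)"
proof -
  define g where "g n p = Y (of_int \<lfloor>real (Suc n) * snd p\<rfloor> / real (Suc n)) (fst p)" for n and p :: "'a \<times> real"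
  show ?thesis
  proof (rule borel_measurable_LIMSEQ_real[of _ g])
    fix n
    show "g n \<in> borel_measurable (M \<Otimes>\<^sub>M borel)"
      unfolding g_def
    proof (rule measurable_compose_countable[where f="\<lambda>i p. Y (of_int i / real (Suc n)) (fst p)"])
      show "(\<lambda>p. Y (of_int i / real (Suc n)) (fst p)) \<in> borel_measurable (M \<Otimes>\<^sub>M borel)" for i
        using meas by measurable
      show "(\<lambda>p. \<lfloor>real (Suc n) * snd p\<rfloor>) \<in> measurable (M \<Otimes>\<^sub>M (borel :: real measure)) (count_space UNIV)"
        by measurable
    qed
  next
    fix p assume p: "p \<in> space (M \<Otimes>\<^sub>M (borel :: real measure))"
    obtain \<omega> s where ps: "p = (\<omega>, s)" by force
    with p have \<omega>: "\<omega> \<in> space M" by (simp add: space_pair_measure)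
    have lim: "(\<lambda>n. of_int \<lfloor>real (Suc n) * s\<rfloor> / real (Suc n)) \<longlonglongrightarrow> s"
    proof (rule real_tendsto_sandwich)
      show "\<forall>\<^sub>F n in sequentially. s - 1 / real (Suc n) \<le> of_int \<lfloor>real (Suc n) * s\<rfloor> / real (Suc n)"
      proof (intro always_eventually allI)
        fix n
        have "real (Suc n) * s - 1 \<le> of_int \<lfloor>real (Suc n) * s\<rfloor>" by linarith
        then show "s - 1 / real (Suc n) \<le> of_int \<lfloor>real (Suc n) * s\<rfloor> / real (Suc n)"
          by (subst pos_le_divide_eq) (simp_all add: right_diff_distrib mult.commute)
      qed
      show "\<forall>\<^sub>F n in sequentially. of_int \<lfloor>real (Suc n) * s\<rfloor> / real (Suc n) \<le> s"
      proof (intro always_eventually allI)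
        fix n
        have "of_int \<lfloor>real (Suc n) * s\<rfloor> \<le> real (Suc n) * s" by linarith
        then show "of_int \<lfloor>real (Suc n) * s\<rfloor> / real (Suc n) \<le> s"
          by (simp add: field_simps)
      qed
      show "(\<lambda>n. s - 1 / real (Suc n)) \<longlonglongrightarrow> s"
        using tendsto_diff[OF tendsto_const[of s] LIMSEQ_Suc[OF lim_1_over_n[where 'a=real]]] by simp
    qed simp
    show "(\<lambda>n. g n p) \<longlonglongrightarrow> (case p of (\<omega>, s) \<Rightarrow> Y s \<omega>)"
      using continuous_on_tendsto_compose[OF cont[OF \<omega>] lim] ps by (simp add: g_def)
  qed
qed

lemma borel_measurable_eq_off_null:
  fixes f g :: "'a \<Rightarrow> real"
  assumes f: "f \<in> borel_measurable M" and N: "N \<in> sets M"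
    and sub: "\<And>A. A \<subseteq> N \<Longrightarrow> A \<in> sets M"
    and eq: "\<And>\<omega>. \<omega> \<in> space M - N \<Longrightarrow> g \<omega> = f \<omega>"
  shows "g \<in> borel_measurable M"
proof (rule measurableI)
  fix B :: "real set" assume B: "B \<in> sets borel"
  have "g -` B \<inter> space M = (f -` B \<inter> space M - N) \<union> (g -` B \<inter> space M \<inter> N)"
    using eq by auto
  moreover have "f -` B \<inter> space M - N \<in> sets M" using measurable_sets[OF f B] N by blast
  moreover have "g -` B \<inter> space M \<inter> N \<in> sets M" by (rule sub) auto
  ultimately show "g -` B \<inter> space M \<in> sets M" by (metis sets.Un)
qed simp

section \<open>The stopping game for a positive process with continuous paths\<close>

text \<open>
  The features of the geometric Brownian motion behind the thresholds: positivity, paths continuous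
  off a null set \<open>N\<close>, and inverse moments bounded over the horizon \<open>[0, h]\<close>. The bound \<open>Rc_growth\<close> makes
  the last of these control the running reward. All subsets of \<open>N\<close> are required to be measurable
  because the payoff integrand is arbitrary on \<open>N\<close>, and a Bochner integral of a nonmeasurable function is \<open>0\<close>.
\<close>

locale stopping_game = prob_space Q
  for Q :: "'a measure" +
  fixes X :: "real \<Rightarrow> 'a \<Rightarrow> real" and N :: "'a set" and S :: "('a \<Rightarrow> real) set"
    and h r f c\<^sub>p c\<^sub>m K A B :: real and Rc :: "real \<Rightarrow> real"
  assumes h_pos: "0 < h" and r_pos: "0 < r" and f_pos: "0 < f"
    and c\<^sub>m_pos: "0 < c\<^sub>m" and c\<^sub>m_less: "c\<^sub>m < c\<^sub>p"
    and X_pos: "\<And>s \<omega>. 0 < X s \<omega>"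
    and X_measurable: "\<And>s. 0 \<le> s \<Longrightarrow> X s \<in> borel_measurable Q"
    and N_null: "N \<in> null_sets Q" and subset_N: "\<And>A. A \<subseteq> N \<Longrightarrow> A \<in> sets Q"
    and X_continuous: "\<And>\<omega>. \<omega> \<in> space Q - N \<Longrightarrow> continuous_on {0..} (\<lambda>s. X s \<omega>)"
    and K_nonneg: "0 \<le> K"
    and inverse_moment: "\<And>s. 0 \<le> s \<Longrightarrow> s \<le> h \<Longrightarrow> (\<integral>\<^sup>+\<omega>. ennreal (1 / X s \<omega>) \<partial>Q) \<le> ennreal K"
    and Rc_continuous: "continuous_on {0<..} Rc"
    and Rc_antitone: "\<And>x y. 0 < x \<Longrightarrow> x \<le> y \<Longrightarrow> Rc y \<le> Rc x"
    and Rc_nonneg: "\<And>x. 0 < x \<Longrightarrow> 0 \<le> Rc x"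
    and A_nonneg: "0 \<le> A" and B_nonneg: "0 \<le> B"
    and Rc_growth: "\<And>x. 0 < x \<Longrightarrow> Rc x \<le> A + B / x"
    and Rc_at_0: "filterlim Rc at_top (at_right 0)" and Rc_at_top: "(Rc \<longlongrightarrow> 0) at_top"
    and S_measurable: "\<And>\<tau>. \<tau> \<in> S \<Longrightarrow> \<tau> \<in> borel_measurable Q"
    and S_range: "\<And>\<tau> \<omega>. \<tau> \<in> S \<Longrightarrow> \<omega> \<in> space Q \<Longrightarrow> 0 \<le> \<tau> \<omega> \<and> \<tau> \<omega> \<le> h"
    and zero_in_S: "(\<lambda>_. 0) \<in> S" and h_in_S: "(\<lambda>_. h) \<in> S"
begin

definition accumulated :: "(real \<Rightarrow> real) \<Rightarrow> real \<Rightarrow> 'a \<Rightarrow> real" where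
  "accumulated g a \<omega> = (LBINT s:{0..a}. exp (- r * s) * g (X s \<omega>))"

abbreviation reward :: "real \<Rightarrow> real \<Rightarrow> 'a \<Rightarrow> real" where
  "reward y \<equiv> accumulated (\<lambda>x. Rc (y * x))"

definition expected_reward :: "real \<Rightarrow> real" where
  "expected_reward y = expectation (reward y h)"

text \<open>
  The part of the payoff that does not depend on \<open>y\<close>: the payments at the end of the game, with the
  terminal payment \<open>c\<^sub>m / f\<close> at the horizon.
\<close>

definition payment :: "('a \<Rightarrow> real) \<Rightarrow> ('a \<Rightarrow> real) \<Rightarrow> 'a \<Rightarrow> real" where
  "payment \<sigma> \<tau> \<omega> = c\<^sub>p / f * exp (- r * \<sigma> \<omega>) * of_bool (\<sigma> \<omega> \<le> \<tau> \<omega>) * of_bool (\<sigma> \<omega> < h)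
     + c\<^sub>m / f * exp (- r * \<tau> \<omega>) * of_bool (\<tau> \<omega> < \<sigma> \<omega>)
     + exp (- r * h) * (c\<^sub>m / f) * of_bool (\<tau> \<omega> = h \<and> \<sigma> \<omega> = h)"

definition payoff :: "real \<Rightarrow> ('a \<Rightarrow> real) \<Rightarrow> ('a \<Rightarrow> real) \<Rightarrow> real" where
  "payoff y \<sigma> \<tau> = expectation (\<lambda>\<omega>. payment \<sigma> \<tau> \<omega> + reward y (min (\<tau> \<omega>) (\<sigma> \<omega>)) \<omega>)"

lemma scaled_Rc_continuous: "0 < y \<Longrightarrow> continuous_on {0<..} (\<lambda>x. Rc (y * x))"
  by (intro continuous_on_compose2[OF Rc_continuous]) (auto intro!: continuous_intros)

lemma integrand_continuous:
  assumes "continuous_on {0<..} g" "\<omega> \<in> space Q - N"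
  shows "continuous_on {0..a} (\<lambda>s. exp (- r * s) * g (X s \<omega>))"
proof -
  have "continuous_on {0..a} (\<lambda>s. X s \<omega>)"
    using X_continuous[OF assms(2)] by (rule continuous_on_subset) auto
  then show ?thesis using X_pos
    by (intro continuous_intros continuous_on_compose2[OF assms(1)]) auto
qed

lemma integrand_integrable:
  assumes "continuous_on {0<..} g" "\<omega> \<in> space Q - N"
  shows "set_integrable lborel {0..a} (\<lambda>s. exp (- r * s) * g (X s \<omega>))"
  using integrand_continuous[OF assms] by (rule borel_integrable_atLeastAtMost')

lemma accumulated_diff:
  assumes "continuous_on {0<..} g1" "continuous_on {0<..} g2" "\<omega> \<in> space Q - N"
  shows "accumulated (\<lambda>x. g1 x - g2 x) a \<omega> = accumulated g1 a \<omega> - accumulated g2 a \<omega>"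
proof -
  have "accumulated g1 a \<omega> - accumulated g2 a \<omega> =
      (LBINT s:{0..a}. exp (- r * s) * g1 (X s \<omega>) - exp (- r * s) * g2 (X s \<omega>))"
    unfolding accumulated_def
    by (rule set_integral_diff(2)[OF integrand_integrable[OF assms(1,3)]
          integrand_integrable[OF assms(2,3)], symmetric])
  then show ?thesis by (simp only: accumulated_def right_diff_distrib)
qed

lemma accumulated_nonneg:
  assumes "\<And>x. 0 < x \<Longrightarrow> 0 \<le> g x"
  shows "0 \<le> accumulated g a \<omega>"
  unfolding accumulated_def set_lebesgue_integral_def using assms X_pos
  by (intro integral_nonneg_AE AE_I2) (auto simp: indicator_def)

lemma accumulated_mono:
  assumes g: "continuous_on {0<..} g" "\<And>x. 0 < x \<Longrightarrow> 0 \<le> g x" and "\<omega> \<in> space Q - N" "a \<le> b"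
  shows "accumulated g a \<omega> \<le> accumulated g b \<omega>"
  unfolding accumulated_def set_lebesgue_integral_def
proof (rule integral_mono)
  show "indicator {0..a} s *\<^sub>R (exp (- r * s) * g (X s \<omega>)) \<le> indicator {0..b} s *\<^sub>R (exp (- r * s) * g (X s \<omega>))" for s
    using assms X_pos by (auto simp: indicator_def)
qed (use integrand_integrable[OF g(1) assms(3)] in \<open>auto simp: set_integrable_def\<close>)

lemma accumulated_0 [simp]: "accumulated g 0 \<omega> = 0"
proof -
  have "AE s in lborel. s \<noteq> (0::real)" by (rule AE_lborel_singleton)
  then have "AE s in lborel. indicator {0..0} s *\<^sub>R (exp (- r * s) * g (X s \<omega>)) = 0"
    by eventually_elim (auto simp: indicator_def)
  then show ?thesis
    unfolding accumulated_def set_lebesgue_integral_def by (rule integral_eq_zero_AE)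
qed

text \<open>
  The constant value on \<open>N\<close> and the truncation of negative times make every path continuous on the
  whole line, as the joint measurability argument requires.
\<close>

definition regular_X :: "real \<Rightarrow> 'a \<Rightarrow> real" where
  "regular_X s \<omega> = (if \<omega> \<in> N then 1 else X (max 0 s) \<omega>)"

lemma regular_X_measurable: "(\<lambda>(\<omega>, s). regular_X s \<omega>) \<in> borel_measurable (Q \<Otimes>\<^sub>M lborel)"
proof -
  have "(\<lambda>(\<omega>, s). regular_X s \<omega>) \<in> borel_measurable (Q \<Otimes>\<^sub>M borel)"
  proof (rule borel_measurable_pair_continuous_paths)
    show "regular_X s \<in> borel_measurable Q" for s
      using N_null X_measurable[of "max 0 s"] unfolding regular_X_def by (intro measurable_If_set) auto
    show "continuous_on UNIV (\<lambda>s. regular_X s \<omega>)" if "\<omega> \<in> space Q" for \<omega>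
    proof (cases "\<omega> \<in> N")
      case False
      then show ?thesis
        unfolding regular_X_def using X_continuous[of \<omega>] that
        by (auto intro!: continuous_on_compose2[of "{0..}" "\<lambda>s. X s \<omega>"] continuous_intros)
    qed (simp add: regular_X_def)
  qed
  then show ?thesis by (simp cong: measurable_cong_sets sets_pair_measure_cong)
qed

text \<open>
  Off \<open>N\<close> the process may be replaced by its jointly measurable modification, so that Fubini's
  theorem applies; on \<open>N\<close> measurability is automatic.
\<close>

lemma accumulated_measurable:
  assumes g: "continuous_on {0<..} g" and [measurable]: "\<alpha> \<in> borel_measurable Q"
  shows "(\<lambda>\<omega>. accumulated g (\<alpha> \<omega>) \<omega>) \<in> borel_measurable Q"
proof -
  define g' where "g' x = indicator {0<..} x *\<^sub>R g x" for x
  have [measurable]: "g' \<in> borel_measurable borel"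
    unfolding g'_def using g by (intro borel_measurable_continuous_on_indicator) auto
  note [measurable] = regular_X_measurable
  define k where "k = (\<lambda>(\<omega>, s). indicator {0..\<alpha> \<omega>} s *\<^sub>R (exp (- r * s) * g' (regular_X s \<omega>)))"
  have "k = (\<lambda>p. of_bool (0 \<le> snd p \<and> snd p \<le> \<alpha> (fst p)) * (exp (- r * snd p) * g' (case p of (\<omega>, s) \<Rightarrow> regular_X s \<omega>)))"
    by (auto simp: k_def indicator_def fun_eq_iff)
  also have "\<dots> \<in> borel_measurable (Q \<Otimes>\<^sub>M lborel)"
    by measurable
  finally have "k \<in> borel_measurable (Q \<Otimes>\<^sub>M lborel)" .
  then have "(\<lambda>\<omega>. \<integral>s. k (\<omega>, s) \<partial>lborel) \<in> borel_measurable Q"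
    unfolding k_def using lborel.borel_measurable_lebesgue_integral[of "\<lambda>\<omega> s. k (\<omega>, s)" Q]
    by (simp add: k_def split_def)
  then show ?thesis
  proof (rule borel_measurable_eq_off_null)
    fix \<omega> assume \<omega>: "\<omega> \<in> space Q - N"
    show "accumulated g (\<alpha> \<omega>) \<omega> = (\<integral>s. k (\<omega>, s) \<partial>lborel)"
      unfolding accumulated_def set_lebesgue_integral_def k_def g'_def using \<omega> X_pos
      by (intro Bochner_Integration.integral_cong) (auto simp: indicator_def regular_X_def max_def)
  qed (use N_null subset_N in auto)
qed

lemma accumulated_tendsto:
  assumes g: "continuous_on {0<..} g" and gn: "\<And>n. continuous_on {0<..} (gn n)" and w: "continuous_on {0<..} w"
    and lim: "\<And>x. 0 < x \<Longrightarrow> (\<lambda>n. gn n x) \<longlonglongrightarrow> g x" and le: "\<And>n x. 0 < x \<Longrightarrow> \<bar>gn n x\<bar> \<le> w x"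
    and \<omega>: "\<omega> \<in> space Q - N"
  shows "(\<lambda>n. accumulated (gn n) a \<omega>) \<longlonglongrightarrow> accumulated g a \<omega>"
  unfolding accumulated_def set_lebesgue_integral_def
proof (rule integral_dominated_convergence[where w="\<lambda>s. indicator {0..a} s *\<^sub>R (exp (- r * s) * w (X s \<omega>))"])
  show "AE s in lborel. (\<lambda>n. indicator {0..a} s *\<^sub>R (exp (- r * s) * gn n (X s \<omega>))) \<longlonglongrightarrow>
      indicator {0..a} s *\<^sub>R (exp (- r * s) * g (X s \<omega>))"
    using X_pos by (intro AE_I2 tendsto_intros lim) auto
  show "AE s in lborel. norm (indicator {0..a} s *\<^sub>R (exp (- r * s) * gn n (X s \<omega>)))
      \<le> indicator {0..a} s *\<^sub>R (exp (- r * s) * w (X s \<omega>))" for n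
    using X_pos by (intro AE_I2) (auto simp: indicator_def abs_mult le)
qed (use integrand_integrable[OF g \<omega>] integrand_integrable[OF gn \<omega>] integrand_integrable[OF w \<omega>] in
      \<open>auto simp: set_integrable_def dest: borel_measurable_integrable\<close>)

lemma AE_regular: "AE \<omega> in Q. \<omega> \<in> space Q - N"
  using AE_not_in[OF N_null] by (auto elim: eventually_mono simp: AE_space)

lemma reward_nonneg: "0 < y \<Longrightarrow> 0 \<le> reward y a \<omega>"
  by (intro accumulated_nonneg Rc_nonneg) auto

text \<open>
  By Tonelli's theorem: \<open>Rc (y X\<^sub>s) \<le> A + (B / y) (1 / X\<^sub>s)\<close>, and the inverse moments of \<open>X\<close> are
  bounded on \<open>[0, h]\<close>.
\<close>

lemma reward_integrable:
  assumes y: "0 < y"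
  shows "integrable Q (reward y h)"
proof (rule integrableI_nonneg)
  show "reward y h \<in> borel_measurable Q"
    using accumulated_measurable[OF scaled_Rc_continuous[OF y], of "\<lambda>_. h"] by simp
  show "AE \<omega> in Q. 0 \<le> reward y h \<omega>" using reward_nonneg[OF y] by simp
  define bnd where "bnd \<omega> s = indicator {0..h} s * ennreal (A + B / y * (1 / regular_X s \<omega>))" for \<omega> s
  note [measurable] = regular_X_measurable
  have meas: "(\<lambda>(\<omega>, s). bnd \<omega> s) \<in> borel_measurable (Q \<Otimes>\<^sub>M lborel)"
  proof -
    have "(\<lambda>p. indicator {0..h} (snd p) * ennreal (A + B / y * (1 / (case p of (\<omega>, s) \<Rightarrow> regular_X s \<omega>))))
        \<in> borel_measurable (Q \<Otimes>\<^sub>M lborel)" by measurable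
    then show ?thesis by (simp add: bnd_def split_def)
  qed
  interpret pair_sigma_finite Q lborel ..
  have "(\<integral>\<^sup>+\<omega>. ennreal (reward y h \<omega>) \<partial>Q) \<le> (\<integral>\<^sup>+\<omega>. (\<integral>\<^sup>+s. bnd \<omega> s \<partial>lborel) \<partial>Q)"
  proof (rule nn_integral_mono_AE)
    show "AE \<omega> in Q. ennreal (reward y h \<omega>) \<le> (\<integral>\<^sup>+s. bnd \<omega> s \<partial>lborel)"
      using AE_regular
    proof eventually_elim
      case (elim \<omega>)
      have "ennreal (reward y h \<omega>) = (\<integral>\<^sup>+s. ennreal (indicator {0..h} s *\<^sub>R (exp (- r * s) * Rc (y * X s \<omega>))) \<partial>lborel)"
        unfolding accumulated_def set_lebesgue_integral_def
        using integrand_integrable[OF scaled_Rc_continuous[OF y] elim] X_pos y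
        by (intro nn_integral_eq_integral[symmetric])
           (auto simp: set_integrable_def indicator_def intro!: Rc_nonneg AE_I2 mult_nonneg_nonneg)
      also have "\<dots> \<le> (\<integral>\<^sup>+s. bnd \<omega> s \<partial>lborel)"
      proof (rule nn_integral_mono)
        fix s
        show "ennreal (indicator {0..h} s *\<^sub>R (exp (- r * s) * Rc (y * X s \<omega>))) \<le> bnd \<omega> s"
        proof (cases "s \<in> {0..h}")
          case True
          have "exp (- r * s) * Rc (y * X s \<omega>) \<le> 1 * Rc (y * X s \<omega>)"
            using True r_pos y X_pos by (intro mult_right_mono Rc_nonneg) auto
          also have "\<dots> \<le> A + B / y * (1 / X s \<omega>)"
            using Rc_growth[of "y * X s \<omega>"] y X_pos[of s \<omega>] by simp
          finally show ?thesis
            using True elim by (simp add: bnd_def regular_X_def ennreal_leI)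
        qed (simp add: bnd_def)
      qed
      finally show ?case .
    qed
  qed
  also have "\<dots> = (\<integral>\<^sup>+s. (\<integral>\<^sup>+\<omega>. bnd \<omega> s \<partial>Q) \<partial>lborel)"
    using meas by (rule Fubini'[symmetric])
  also have "\<dots> \<le> (\<integral>\<^sup>+s. indicator {0..h} s * ennreal (A + B / y * K) \<partial>lborel)"
  proof (rule nn_integral_mono)
    fix s
    show "(\<integral>\<^sup>+\<omega>. bnd \<omega> s \<partial>Q) \<le> indicator {0..h} s * ennreal (A + B / y * K)"
    proof (cases "s \<in> {0..h}")
      case True
      then have [measurable]: "X s \<in> borel_measurable Q" using X_measurable by simp
      have "(\<integral>\<^sup>+\<omega>. bnd \<omega> s \<partial>Q) = (\<integral>\<^sup>+\<omega>. ennreal A + ennreal (B / y) * ennreal (1 / X s \<omega>) \<partial>Q)"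
      proof (rule nn_integral_cong_AE)
        show "AE \<omega> in Q. bnd \<omega> s = ennreal A + ennreal (B / y) * ennreal (1 / X s \<omega>)"
          using AE_regular
        proof eventually_elim
          case (elim \<omega>)
          have "0 \<le> B / y" "0 \<le> 1 / X s \<omega>"
            using B_nonneg y X_pos[of s \<omega>] by auto
          then show ?case
            using True elim A_nonneg
            by (simp add: bnd_def regular_X_def ennreal_mult[symmetric] ennreal_plus[symmetric]
                del: ennreal_plus times_divide_eq_left times_divide_eq_right)
        qed
      qed
      also have "\<dots> = ennreal A + ennreal (B / y) * (\<integral>\<^sup>+\<omega>. ennreal (1 / X s \<omega>) \<partial>Q)"
        by (simp add: nn_integral_add nn_integral_cmult emeasure_space_1)
      also have "\<dots> \<le> ennreal A + ennreal (B / y) * ennreal K"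
        using True inverse_moment[of s] by (intro add_left_mono mult_left_mono) auto
      also have "\<dots> = ennreal (A + B / y * K)"
        using A_nonneg B_nonneg K_nonneg y
        by (simp add: ennreal_mult[symmetric] ennreal_plus[symmetric] del: ennreal_plus)
      finally show ?thesis using True by simp
    qed (simp add: bnd_def)
  qed
  also have "\<dots> = ennreal (A + B / y * K) * ennreal h"
    using h_pos by (subst mult.commute, subst nn_integral_cmult_indicator) auto
  also have "\<dots> < \<infinity>" by (simp add: ennreal_mult_less_top)
  finally show "(\<integral>\<^sup>+\<omega>. ennreal (reward y h \<omega>) \<partial>Q) < \<infinity>" .
qed

text \<open>
  Dominated convergence twice, first in time along each path, then in \<open>\<omega>\<close>; since \<open>Rc\<close> is antitone,
  the reward for the lower bound \<open>L\<close> of the sequence dominates.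
\<close>

lemma expected_reward_tendsto:
  assumes L: "0 < L" "\<And>n. L \<le> u n" and g: "continuous_on {0<..} g"
    and lim: "\<And>x. 0 < x \<Longrightarrow> (\<lambda>n. Rc (u n * x)) \<longlonglongrightarrow> g x"
  shows "(\<lambda>n. expected_reward (u n)) \<longlonglongrightarrow> expectation (accumulated g h)"
  unfolding expected_reward_def
proof (rule integral_dominated_convergence[where w="reward L h"])
  have u: "0 < u n" for n using L(1) L(2)[of n] by simp
  show "accumulated g h \<in> borel_measurable Q" using accumulated_measurable[OF g, of "\<lambda>_. h"] by simp
  show "reward (u n) h \<in> borel_measurable Q" for n
    using accumulated_measurable[OF scaled_Rc_continuous[OF u], of "\<lambda>_. h"] by simp
  show "integrable Q (reward L h)" using L(1) by (rule reward_integrable)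
  have le: "Rc (u n * x) \<le> Rc (L * x)" if "0 < x" for n x
    using L that by (intro Rc_antitone) auto
  show "AE \<omega> in Q. (\<lambda>n. reward (u n) h \<omega>) \<longlonglongrightarrow> accumulated g h \<omega>"
    using AE_regular
  proof eventually_elim
    case (elim \<omega>)
    show ?case
    proof (rule accumulated_tendsto[where w="\<lambda>x. Rc (L * x)"])
      show "\<bar>Rc (u n * x)\<bar> \<le> Rc (L * x)" if "0 < x" for n x
        using le[OF that] Rc_nonneg[of "u n * x"] u that by simp
    qed (use elim L g lim scaled_Rc_continuous u in auto)
  qed
  show "AE \<omega> in Q. norm (reward (u n) h \<omega>) \<le> reward L h \<omega>" for n
    using AE_regular
  proof eventually_elim
    case (elim \<omega>)
    have "0 \<le> accumulated (\<lambda>x. Rc (L * x) - Rc (u n * x)) h \<omega>"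
      using le by (intro accumulated_nonneg) auto
    then show ?case
      using accumulated_diff[OF scaled_Rc_continuous scaled_Rc_continuous elim, of L "u n" h] L u
        reward_nonneg[OF u, of n h \<omega>] by simp
  qed
qed

lemma expected_reward_continuous: "continuous_on {0<..} expected_reward"
proof -
  have "isCont expected_reward y" if y: "0 < y" for y
  proof -
    \<comment> \<open>Staying above \<open>y / 2\<close> keeps the sequences away from the singularity of \<open>Rc\<close>.\<close>
    have "continuous_on {y / 2<..} expected_reward"
      unfolding continuous_on_sequentially
    proof (intro ballI allI impI, elim conjE)
      fix u :: "nat \<Rightarrow> real" and a
      assume a: "a \<in> {y / 2<..}" and u: "\<forall>n. u n \<in> {y / 2<..}" "u \<longlonglongrightarrow> a"
      have a0: "0 < a" using a y by simp
      have u_ge: "y / 2 \<le> u n" for n using u(1)[rule_format, of n] by simp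
      have u0: "0 < u n" for n using u_ge[of n] y by simp
      have "(\<lambda>n. expected_reward (u n)) \<longlonglongrightarrow> expected_reward a"
        unfolding expected_reward_def[of a]
      proof (rule expected_reward_tendsto[of "y / 2"])
        show "(\<lambda>n. Rc (u n * x)) \<longlonglongrightarrow> Rc (a * x)" if "0 < x" for x
        proof (rule continuous_on_tendsto_compose[OF Rc_continuous])
          show "(\<lambda>n. u n * x) \<longlonglongrightarrow> a * x" using u(2) by (rule tendsto_mult_right)
        qed (use that a0 u0 in simp_all)
        show "continuous_on {0<..} (\<lambda>x. Rc (a * x))" using a0 by (rule scaled_Rc_continuous)
      qed (use y u_ge in simp_all)
      then show "(expected_reward \<circ> u) \<longlonglongrightarrow> expected_reward a" by (simp only: o_def)
    qed
    then show ?thesis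
      using y continuous_on_eq_continuous_at[OF open_greaterThan, of "y / 2" expected_reward] by auto
  qed
  then show ?thesis by (simp add: continuous_on_eq_continuous_at)
qed

lemma expected_reward_vanishes: "(\<lambda>n. expected_reward (real (Suc n))) \<longlonglongrightarrow> 0"
proof -
  have "(\<lambda>n. expected_reward (real (Suc n))) \<longlonglongrightarrow> expectation (accumulated (\<lambda>_. 0) h)"
  proof (rule expected_reward_tendsto[of 1])
    show "(\<lambda>n. Rc (real (Suc n) * x)) \<longlonglongrightarrow> 0" if "0 < x" for x
    proof (rule filterlim_compose[OF Rc_at_top])
      show "filterlim (\<lambda>n. real (Suc n) * x) at_top sequentially"
        using that by real_asymp
    qed
  qed auto
  also have "accumulated (\<lambda>_. 0) h = (\<lambda>_. 0)" by (auto simp: accumulated_def fun_eq_iff set_lebesgue_integral_def)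
  finally show ?thesis by simp
qed

text \<open>
  The three payments exclude each other, and each is at most \<open>c\<^sub>p / f\<close>.
\<close>

lemma payment_bounds:
  assumes "\<sigma> \<in> S" "\<tau> \<in> S" "\<omega> \<in> space Q"
  shows "0 \<le> payment \<sigma> \<tau> \<omega>" "payment \<sigma> \<tau> \<omega> \<le> c\<^sub>p / f"
proof -
  have c: "0 \<le> c\<^sub>m / f" "c\<^sub>m / f \<le> c\<^sub>p / f"
    using c\<^sub>m_pos c\<^sub>m_less f_pos by (auto simp: divide_right_mono)
  have e: "c / f * exp (- r * s) \<le> c / f" if "0 \<le> c / f" "0 \<le> s" for c s
    using that r_pos by (intro mult_left_le) auto
  note R = S_range[OF assms(1,3)] S_range[OF assms(2,3)]
  show "0 \<le> payment \<sigma> \<tau> \<omega>" using c f_pos c\<^sub>m_pos c\<^sub>m_less by (simp add: payment_def)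
  show "payment \<sigma> \<tau> \<omega> \<le> c\<^sub>p / f"
    using R c e[of c\<^sub>p "\<sigma> \<omega>"] e[of c\<^sub>m "\<tau> \<omega>"] e[of c\<^sub>m h] h_pos
    unfolding payment_def by (auto simp: of_bool_def mult.commute)
qed

lemma payment_integrable:
  assumes "\<sigma> \<in> S" "\<tau> \<in> S"
  shows "integrable Q (payment \<sigma> \<tau>)"
proof (rule integrable_const_bound[where B="c\<^sub>p / f"])
  note [measurable] = S_measurable[OF assms(1)] S_measurable[OF assms(2)]
  show "payment \<sigma> \<tau> \<in> borel_measurable Q" unfolding payment_def by measurable
qed (use payment_bounds[OF assms] in auto)

lemma stopped_reward_le:
  assumes "0 < y" "\<tau> \<in> S" "\<omega> \<in> space Q - N"
  shows "reward y (min (\<tau> \<omega>) (\<sigma> \<omega>)) \<omega> \<le> reward y h \<omega>"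
  using assms S_range[OF assms(2), of \<omega>]
  by (intro accumulated_mono scaled_Rc_continuous Rc_nonneg) auto

lemma stopped_reward_integrable:
  assumes y: "0 < y" and \<sigma>: "\<sigma> \<in> S" and \<tau>: "\<tau> \<in> S"
  shows "integrable Q (\<lambda>\<omega>. reward y (min (\<tau> \<omega>) (\<sigma> \<omega>)) \<omega>)"
proof (rule Bochner_Integration.integrable_bound[OF reward_integrable[OF y]])
  show "(\<lambda>\<omega>. reward y (min (\<tau> \<omega>) (\<sigma> \<omega>)) \<omega>) \<in> borel_measurable Q"
    using S_measurable[OF \<sigma>] S_measurable[OF \<tau>]
    by (intro accumulated_measurable[OF scaled_Rc_continuous[OF y]]) measurable
  show "AE \<omega> in Q. norm (reward y (min (\<tau> \<omega>) (\<sigma> \<omega>)) \<omega>) \<le> norm (reward y h \<omega>)"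
    using AE_regular
  proof eventually_elim
    case (elim \<omega>)
    then show ?case using stopped_reward_le[OF y \<tau>, of \<omega> \<sigma>] reward_nonneg[OF y] by simp
  qed
qed

lemma payoff_ge:
  assumes y: "0 < y" and \<sigma>: "\<sigma> \<in> S" and \<tau>: "\<tau> \<in> S" and "integrable Q F"
    and "\<And>\<omega>. \<omega> \<in> space Q - N \<Longrightarrow> F \<omega> \<le> payment \<sigma> \<tau> \<omega> + reward y (min (\<tau> \<omega>) (\<sigma> \<omega>)) \<omega>"
  shows "expectation F \<le> payoff y \<sigma> \<tau>"
  unfolding payoff_def
  using assms payment_integrable[OF \<sigma> \<tau>] stopped_reward_integrable[OF y \<sigma> \<tau>] AE_regular
  by (intro integral_mono_AE) (auto elim: eventually_mono)

lemma payoff_le: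
  assumes y: "0 < y" and \<sigma>: "\<sigma> \<in> S" and \<tau>: "\<tau> \<in> S" and "integrable Q F"
    and "\<And>\<omega>. \<omega> \<in> space Q - N \<Longrightarrow> payment \<sigma> \<tau> \<omega> + reward y (min (\<tau> \<omega>) (\<sigma> \<omega>)) \<omega> \<le> F \<omega>"
  shows "payoff y \<sigma> \<tau> \<le> expectation F"
  unfolding payoff_def
  using assms payment_integrable[OF \<sigma> \<tau>] stopped_reward_integrable[OF y \<sigma> \<tau>] AE_regular
  by (intro integral_mono_AE) (auto elim: eventually_mono)

lemma payoff_nonneg:
  assumes "0 < y" "\<sigma> \<in> S" "\<tau> \<in> S"
  shows "0 \<le> payoff y \<sigma> \<tau>"
  using payoff_ge[OF assms, of "\<lambda>_. 0"] payment_bounds(1)[OF assms(2,3)] reward_nonneg[OF assms(1)]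
  by auto

lemma payoff_le_expected_reward:
  assumes "0 < y" "\<sigma> \<in> S" "\<tau> \<in> S"
    and c: "\<And>\<omega>. \<omega> \<in> space Q \<Longrightarrow> payment \<sigma> \<tau> \<omega> \<le> c"
  shows "payoff y \<sigma> \<tau> \<le> c + expected_reward y"
proof -
  have "payoff y \<sigma> \<tau> \<le> expectation (\<lambda>\<omega>. c + reward y h \<omega>)"
    using reward_integrable[OF assms(1)] c stopped_reward_le[OF assms(1,3)]
    by (intro payoff_le[OF assms(1-3)]) (auto intro!: add_mono)
  then show ?thesis
    using reward_integrable[OF assms(1)] by (simp add: expected_reward_def prob_space)
qed

text \<open>
  The payments at the end of the game cancel. Since \<open>Rc\<close> is antitone, the remaining rate
  \<open>Rc (y1 x) - Rc (y2 x)\<close> is nonnegative, so its integral up to any stopping time is at most that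
  over the full horizon. This is the estimate, uniform in the strategies, that gives monotonicity
  and continuity of the value.
\<close>

lemma payoff_diff:
  assumes y: "0 < y1" "y1 \<le> y2" and \<sigma>: "\<sigma> \<in> S" and \<tau>: "\<tau> \<in> S"
  shows "payoff y2 \<sigma> \<tau> \<le> payoff y1 \<sigma> \<tau>"
    and "payoff y1 \<sigma> \<tau> \<le> payoff y2 \<sigma> \<tau> + (expected_reward y1 - expected_reward y2)"
proof -
  have y2: "0 < y2" using y by simp
  define d where "d = (\<lambda>x. Rc (y1 * x) - Rc (y2 * x))"
  have d: "continuous_on {0<..} d" "0 \<le> d x" if "0 < x" for x
    unfolding d_def using y y2 that scaled_Rc_continuous
    by (auto intro!: continuous_intros Rc_antitone mult_right_mono)
  have d_accumulated: "accumulated d a \<omega> = reward y1 a \<omega> - reward y2 a \<omega>" if "\<omega> \<in> space Q - N" for a \<omega>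
    unfolding d_def
    by (rule accumulated_diff[OF scaled_Rc_continuous[OF y(1)] scaled_Rc_continuous[OF y2] that])
  note int = payment_integrable[OF \<sigma> \<tau>] stopped_reward_integrable[OF y(1) \<sigma> \<tau>]
    stopped_reward_integrable[OF y2 \<sigma> \<tau>] reward_integrable[OF y(1)] reward_integrable[OF y2]
  show "payoff y2 \<sigma> \<tau> \<le> payoff y1 \<sigma> \<tau>"
    unfolding payoff_def[of y2]
  proof (rule payoff_ge[OF y(1) \<sigma> \<tau>])
    fix \<omega> assume "\<omega> \<in> space Q - N"
    then show "payment \<sigma> \<tau> \<omega> + reward y2 (min (\<tau> \<omega>) (\<sigma> \<omega>)) \<omega>
      \<le> payment \<sigma> \<tau> \<omega> + reward y1 (min (\<tau> \<omega>) (\<sigma> \<omega>)) \<omega>"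
      using accumulated_nonneg[of d "min (\<tau> \<omega>) (\<sigma> \<omega>)" \<omega>, OF d(2)] d_accumulated by simp
  qed (use int in auto)
  have "payoff y1 \<sigma> \<tau> \<le> expectation (\<lambda>\<omega>. payment \<sigma> \<tau> \<omega> + reward y2 (min (\<tau> \<omega>) (\<sigma> \<omega>)) \<omega>
      + (reward y1 h \<omega> - reward y2 h \<omega>))"
  proof (rule payoff_le[OF y(1) \<sigma> \<tau>])
    fix \<omega> assume \<omega>: "\<omega> \<in> space Q - N"
    then have "accumulated d (min (\<tau> \<omega>) (\<sigma> \<omega>)) \<omega> \<le> accumulated d h \<omega>"
      using S_range[OF \<tau>, of \<omega>] d by (intro accumulated_mono) (auto intro: d(1)[of 1])
    then show "payment \<sigma> \<tau> \<omega> + reward y1 (min (\<tau> \<omega>) (\<sigma> \<omega>)) \<omega>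
      \<le> payment \<sigma> \<tau> \<omega> + reward y2 (min (\<tau> \<omega>) (\<sigma> \<omega>)) \<omega> + (reward y1 h \<omega> - reward y2 h \<omega>)"
      using d_accumulated[OF \<omega>] by simp
  qed (use int in auto)
  also have "\<dots> = payoff y2 \<sigma> \<tau> + (expected_reward y1 - expected_reward y2)"
    using int by (simp add: payoff_def expected_reward_def)
  finally show "payoff y1 \<sigma> \<tau> \<le> payoff y2 \<sigma> \<tau> + (expected_reward y1 - expected_reward y2)" .
qed

definition val :: "real \<Rightarrow> real" where
  "val y = inf_sup S (payoff y)"

lemma S_nonempty: "S \<noteq> {}" using zero_in_S by blast

lemma payoff_upper:
  assumes "0 < y" "\<sigma> \<in> S" "\<tau> \<in> S"
  shows "payoff y \<sigma> \<tau> \<le> c\<^sub>p / f + expected_reward y"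
  using payoff_le_expected_reward[OF assms payment_bounds(2)[OF assms(2,3)]] by simp

lemma val_antitone:
  assumes "0 < y1" "y1 \<le> y2"
  shows "val y2 \<le> val y1"
  unfolding val_def
  using inf_sup_le_add[OF S_nonempty, of 0 "payoff y2" "payoff y1" "c\<^sub>p / f + expected_reward y1" 0] assms
    payoff_nonneg[of y2] payoff_upper[of y1] payoff_diff(1)[OF assms] by simp

lemma val_diff:
  assumes "0 < y1" "y1 \<le> y2"
  shows "val y1 \<le> val y2 + (expected_reward y1 - expected_reward y2)"
  unfolding val_def
  using inf_sup_le_add[OF S_nonempty, of 0 "payoff y1" "payoff y2" "c\<^sub>p / f + expected_reward y2" "expected_reward y1 - expected_reward y2"] assms
    payoff_nonneg[of y1] payoff_upper[of y2] payoff_diff(2)[OF assms] by simp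

lemma val_continuous: "continuous_on {0<..} val"
  unfolding continuous_on_def
proof
  fix y :: real assume y: "y \<in> {0<..}"
  have "((\<lambda>z. val z - val y) \<longlongrightarrow> 0) (at y within {0<..})"
  proof (rule tendsto_0_le[where K=1 and f="\<lambda>z. expected_reward z - expected_reward y"])
    show "((\<lambda>z. expected_reward z - expected_reward y) \<longlongrightarrow> 0) (at y within {0<..})"
      using expected_reward_continuous y unfolding continuous_on_def by (intro LIM_zero) simp
    show "\<forall>\<^sub>F z in at y within {0<..}. norm (val z - val y) \<le> norm (expected_reward z - expected_reward y) * 1"
      unfolding eventually_at_filter
    proof (intro always_eventually allI impI)
      fix z :: real assume "z \<in> {0<..}"
      then show "norm (val z - val y) \<le> norm (expected_reward z - expected_reward y) * 1"
        using y val_antitone[of z y] val_antitone[of y z] val_diff[of z y] val_diff[of y z]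
        by (cases "z \<le> y") auto
    qed
  qed
  then show "(val \<longlongrightarrow> val y) (at y within {0<..})" by (rule LIM_zero_cancel)
qed

text \<open>
  Stopping at once secures the maximiser at least \<open>c\<^sub>m / f\<close>.
\<close>

lemma val_lower:
  assumes y: "0 < y" shows "c\<^sub>m / f \<le> val y"
  unfolding val_def
proof (rule inf_sup_ge[OF S_nonempty payoff_upper[OF y] zero_in_S])
  fix \<sigma> assume \<sigma>: "\<sigma> \<in> S"
  have le: "c\<^sub>m / f \<le> c\<^sub>p / f" using c\<^sub>m_less f_pos by (simp add: divide_right_mono)
  have "expectation (\<lambda>_. c\<^sub>m / f) \<le> payoff y \<sigma> (\<lambda>_. 0)"
  proof (rule payoff_ge[OF y \<sigma> zero_in_S])
    fix \<omega> assume "\<omega> \<in> space Q - N"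
    then have "0 \<le> \<sigma> \<omega>" using S_range[OF \<sigma>] by simp
    then have "c\<^sub>m / f \<le> payment \<sigma> (\<lambda>_. 0) \<omega>"
      using le h_pos by (cases "\<sigma> \<omega> = 0") (simp_all add: payment_def)
    then show "c\<^sub>m / f \<le> payment \<sigma> (\<lambda>_. 0) \<omega> + reward y (min 0 (\<sigma> \<omega>)) \<omega>"
      using reward_nonneg[OF y, of "min 0 (\<sigma> \<omega>)" \<omega>] by simp
  qed simp
  then show "c\<^sub>m / f \<le> payoff y \<sigma> (\<lambda>_. 0)" by (simp add: prob_space)
qed

text \<open>
  Stopping at once costs the minimiser \<open>c\<^sub>p / f\<close>, whatever the opponent does.
\<close>

lemma val_upper:
  assumes y: "0 < y" shows "val y \<le> c\<^sub>p / f"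
  unfolding val_def
proof (rule inf_sup_le[OF payoff_nonneg[OF y] payoff_upper[OF y] zero_in_S])
  fix \<tau> assume \<tau>: "\<tau> \<in> S"
  have "payoff y (\<lambda>_. 0) \<tau> \<le> expectation (\<lambda>_. c\<^sub>p / f)"
  proof (rule payoff_le[OF y zero_in_S \<tau>])
    fix \<omega> assume "\<omega> \<in> space Q - N"
    then have "min (\<tau> \<omega>) 0 = 0" "payment (\<lambda>_. 0) \<tau> \<omega> \<le> c\<^sub>p / f"
      using S_range[OF \<tau>, of \<omega>] payment_bounds[OF zero_in_S \<tau>] by auto
    then show "payment (\<lambda>_. 0) \<tau> \<omega> + reward y (min (\<tau> \<omega>) 0) \<omega> \<le> c\<^sub>p / f" by simp
  qed auto
  then show "payoff y (\<lambda>_. 0) \<tau> \<le> c\<^sub>p / f" by (simp add: prob_space)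
qed

text \<open>
  A minimiser who never stops pays no \<open>c\<^sub>p\<close>: at most \<open>c\<^sub>m / f\<close> and the running reward.
\<close>

lemma val_le_expected_reward:
  assumes y: "0 < y" shows "val y \<le> c\<^sub>m / f + expected_reward y"
  unfolding val_def
proof (rule inf_sup_le[OF payoff_nonneg[OF y] payoff_upper[OF y] h_in_S])
  fix \<tau> assume \<tau>: "\<tau> \<in> S"
  show "payoff y (\<lambda>_. h) \<tau> \<le> c\<^sub>m / f + expected_reward y"
  proof (rule payoff_le_expected_reward[OF y h_in_S \<tau>])
    fix \<omega> assume "\<omega> \<in> space Q"
    have e: "c\<^sub>m / f * exp (- r * s) \<le> c\<^sub>m / f" if "0 \<le> s" for s
      using that r_pos c\<^sub>m_pos f_pos by (intro mult_left_le) auto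
    show "payment (\<lambda>_. h) \<tau> \<omega> \<le> c\<^sub>m / f"
      using S_range[OF \<tau> \<open>\<omega> \<in> space Q\<close>] e[of "\<tau> \<omega>"] e[of h] h_pos c\<^sub>m_pos f_pos
      unfolding payment_def by (auto simp: of_bool_def mult.commute)
  qed
qed

text \<open>
  For large \<open>y\<close> the running reward is small, and never stopping is cheaper for the minimiser than
  the payment \<open>c\<^sub>p / f\<close>.
\<close>

lemma val_not_upper: "\<exists>y>0. val y < c\<^sub>p / f"
proof -
  have "0 < (c\<^sub>p - c\<^sub>m) / f" using c\<^sub>m_less f_pos by simp
  then have "\<forall>\<^sub>F n in sequentially. expected_reward (real (Suc n)) < (c\<^sub>p - c\<^sub>m) / f"
    by (rule order_tendstoD(2)[OF expected_reward_vanishes])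
  then obtain n where n: "expected_reward (real (Suc n)) < (c\<^sub>p - c\<^sub>m) / f"
    using eventually_happens'[OF sequentially_bot] by blast
  have "val (real (Suc n)) < c\<^sub>p / f"
    using val_le_expected_reward[of "real (Suc n)"] n by (simp add: diff_divide_distrib)
  then show ?thesis by (intro exI[of _ "real (Suc n)"]) auto
qed

text \<open>
  A continuous path is bounded on \<open>[0, \<delta>]\<close>, so as \<open>y\<close> tends to \<open>0\<close> the rate tends
  to infinity uniformly there.
\<close>

lemma reward_blows_up:
  assumes \<omega>: "\<omega> \<in> space Q - N" and \<delta>: "0 < \<delta>"
  shows "filterlim (\<lambda>n. reward (1 / real (Suc n)) \<delta> \<omega>) at_top sequentially"
proof -
  have "continuous_on {0..\<delta>} (\<lambda>s. X s \<omega>)"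
    by (rule continuous_on_subset[OF X_continuous[OF \<omega>]]) auto
  then have "bdd_above ((\<lambda>s. X s \<omega>) ` {0..\<delta>})"
    by (intro bounded_imp_bdd_above compact_imp_bounded compact_continuous_image) simp_all
  then obtain b where b: "\<And>s. s \<in> {0..\<delta>} \<Longrightarrow> X s \<omega> \<le> b"
    unfolding bdd_above_def by fastforce
  have b0: "0 < b" using b[of 0] X_pos[of 0 \<omega>] \<delta> by simp
  have low: "\<delta> * exp (- r * \<delta>) * Rc (y * b) \<le> reward y \<delta> \<omega>" if y: "0 < y" for y
  proof -
    have "(LBINT s:{0..\<delta>}. exp (- r * \<delta>) * Rc (y * b)) \<le> reward y \<delta> \<omega>"
      unfolding accumulated_def
    proof (rule set_integral_mono)
      show "set_integrable lborel {0..\<delta>} (\<lambda>s. exp (- r * \<delta>) * Rc (y * b))"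
        by (intro borel_integrable_atLeastAtMost' continuous_intros)
      fix s assume s: "s \<in> {0..\<delta>}"
      show "exp (- r * \<delta>) * Rc (y * b) \<le> exp (- r * s) * Rc (y * X s \<omega>)"
        using s b[OF s] b0 y r_pos X_pos[of s \<omega>]
        by (intro mult_mono Rc_antitone Rc_nonneg) auto
    qed (rule integrand_integrable[OF scaled_Rc_continuous[OF y] \<omega>])
    then show ?thesis using \<delta> by (simp add: set_lebesgue_integral_def mult_ac)
  qed
  have "filterlim (\<lambda>n. 1 / real (Suc n) * b) (at_right 0) sequentially"
    using b0 by real_asymp
  then have "filterlim (\<lambda>n. Rc (1 / real (Suc n) * b)) at_top sequentially"
    by (rule filterlim_compose[OF Rc_at_0])
  then have "filterlim (\<lambda>n. \<delta> * exp (- r * \<delta>) * Rc (1 / real (Suc n) * b)) at_top sequentially"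
    using \<delta> by (intro filterlim_tendsto_pos_mult_at_top[OF tendsto_const]) auto
  then show ?thesis
    by (rule filterlim_at_top_mono) (intro always_eventually allI low; simp)
qed

text \<open>
  For small \<open>y\<close> let the maximiser never stop. If the minimiser stops before a small time \<open>\<delta>\<close>, the
  payment is at least \<open>c\<^sub>p / f\<close> discounted over \<open>\<delta>\<close>; otherwise the reward collected up to \<open>\<delta>\<close> is huge.
  So the payoff is at least the expectation of the minimum of the two, a bound that does not
  depend on the minimiser and tends to the former as \<open>y\<close> tends to \<open>0\<close>.
\<close>

lemma val_not_lower: "\<exists>y>0. c\<^sub>m / f < val y"
proof -
  \<comment> \<open>Half of the time in which discounting brings \<open>c\<^sub>p\<close> down to \<open>c\<^sub>m\<close>, cut off at the horizon.\<close>
  define \<delta> where "\<delta> = min h (ln (c\<^sub>p / c\<^sub>m) / (2 * r))"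
  have ratio: "1 < c\<^sub>p / c\<^sub>m" using c\<^sub>m_pos c\<^sub>m_less by simp
  then have \<delta>: "0 < \<delta>" "\<delta> \<le> h" using h_pos r_pos by (auto simp: \<delta>_def)
  have "r * \<delta> \<le> r * (ln (c\<^sub>p / c\<^sub>m) / (2 * r))"
    using r_pos by (intro mult_left_mono) (auto simp: \<delta>_def)
  also have "\<dots> < ln (c\<^sub>p / c\<^sub>m)" using r_pos ratio by simp
  finally have "exp (r * \<delta>) < c\<^sub>p / c\<^sub>m"
    using ratio by (metis exp_less_mono exp_ln less_trans zero_less_one)
  then have less: "c\<^sub>m / f < c\<^sub>p / f * exp (- r * \<delta>)"
    using c\<^sub>m_pos f_pos by (simp add: exp_minus field_simps)
  define b where "b = c\<^sub>p / f * exp (- r * \<delta>)"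
  have b0: "0 < b" using less c\<^sub>m_pos f_pos unfolding b_def by (meson divide_pos_pos less_trans)
  define F where "F n \<omega> = min b (reward (1 / real (Suc n)) \<delta> \<omega>)" for n \<omega>
  have F_meas: "F n \<in> borel_measurable Q" for n
    unfolding F_def using accumulated_measurable[OF scaled_Rc_continuous, of "1 / real (Suc n)" "\<lambda>_. \<delta>"]
    by (intro borel_measurable_min) auto
  have F_bound: "norm (F n \<omega>) \<le> b" for n \<omega>
    using b0 reward_nonneg[of "1 / real (Suc n)" \<delta> \<omega>] by (auto simp: F_def)
  have "(\<lambda>n. expectation (F n)) \<longlonglongrightarrow> expectation (\<lambda>_. b)"
  proof (rule integral_dominated_convergence[where w="\<lambda>_. b"])
    show "AE \<omega> in Q. (\<lambda>n. F n \<omega>) \<longlonglongrightarrow> b"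
      using AE_regular
    proof eventually_elim
      case (elim \<omega>)
      have "\<forall>\<^sub>F n in sequentially. b \<le> reward (1 / real (Suc n)) \<delta> \<omega>"
        using reward_blows_up[OF elim \<delta>(1)] unfolding filterlim_at_top by blast
      then have "\<forall>\<^sub>F n in sequentially. F n \<omega> = b"
        by eventually_elim (simp add: F_def)
      then show ?case by (rule tendsto_eventually)
    qed
  qed (use F_meas F_bound in auto)
  then have "(\<lambda>n. expectation (F n)) \<longlonglongrightarrow> b" by (simp add: prob_space)
  then have "\<forall>\<^sub>F n in sequentially. c\<^sub>m / f < expectation (F n)"
    using less unfolding b_def[symmetric] by (rule order_tendstoD(1))
  then obtain n where n: "c\<^sub>m / f < expectation (F n)"
    using eventually_happens'[OF sequentially_bot] by blast
  define y where "y = 1 / real (Suc n)"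
  have y: "0 < y" by (simp add: y_def)
  have "expectation (F n) \<le> val y"
    unfolding val_def
  proof (rule inf_sup_ge[OF S_nonempty payoff_upper[OF y] h_in_S])
    fix \<sigma> assume \<sigma>: "\<sigma> \<in> S"
    show "expectation (F n) \<le> payoff y \<sigma> (\<lambda>_. h)"
    proof (rule payoff_ge[OF y \<sigma> h_in_S])
      show "integrable Q (F n)"
        by (rule integrable_const_bound[where B=b]) (use F_meas F_bound in auto)
      fix \<omega> assume \<omega>: "\<omega> \<in> space Q - N"
      note R = S_range[OF \<sigma>, of \<omega>]
      show "F n \<omega> \<le> payment \<sigma> (\<lambda>_. h) \<omega> + reward y (min h (\<sigma> \<omega>)) \<omega>"
      proof (cases "\<sigma> \<omega> < \<delta>")
        case True
        have "b \<le> c\<^sub>p / f * exp (- r * \<sigma> \<omega>)"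
          unfolding b_def using True r_pos c\<^sub>m_pos c\<^sub>m_less f_pos by (intro mult_left_mono) auto
        also have "\<dots> = payment \<sigma> (\<lambda>_. h) \<omega>"
          using True \<delta> by (simp add: payment_def)
        finally show ?thesis
          using reward_nonneg[OF y, of "min h (\<sigma> \<omega>)" \<omega>] by (simp add: F_def)
      next
        case False
        have "reward y \<delta> \<omega> \<le> reward y (min h (\<sigma> \<omega>)) \<omega>"
          using False R \<omega> \<delta> y by (intro accumulated_mono scaled_Rc_continuous Rc_nonneg) auto
        then show ?thesis
          using payment_bounds(1)[OF \<sigma> h_in_S, of \<omega>] \<omega> by (simp add: F_def y_def)
      qed
    qed
  qed
  with n y show ?thesis by (intro exI[of _ y]) simp
qed

end

section \<open>The tilted measure\<close>

lemma aug_filtration_generators: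
  assumes "brownian_motion M W"
  shows "(\<Union>s\<in>{0..t}. {W s -` B \<inter> space M | B. B \<in> sets borel}) \<union> null_sets M \<subseteq> sets M"
proof -
  interpret brownian_motion M W by fact
  have "W s -` B \<inter> space M \<in> sets M" if "s \<in> {0..t}" "B \<in> sets borel" for s B
    using measurable_sets[OF random_variable_W, of s B] that by simp
  then show ?thesis by (auto intro: null_setsD2)
qed

lemma sets_aug_filtration:
  assumes "brownian_motion M W"
  shows "sets (aug_filtration M W t) = sigma_sets (space M)
    ((\<Union>s\<in>{0..t}. {W s -` B \<inter> space M | B. B \<in> sets borel}) \<union> null_sets M)"
  unfolding aug_filtration_def
  by (rule sets_measure_of[OF order_trans[OF aug_filtration_generators[OF assms] sets.space_closed]])

lemma space_aug_filtration [simp]: "space (aug_filtration M W t) = space M"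
  by (simp add: aug_filtration_def space_measure_of_conv)

lemma subalgebra_aug_filtration:
  assumes "brownian_motion M W"
  shows "subalgebra M (aug_filtration M W t)"
  using sets.sigma_sets_subset[OF aug_filtration_generators[OF assms]]
  by (simp add: subalgebra_def sets_aug_filtration[OF assms])

lemma null_sets_aug_filtration:
  assumes "brownian_motion M W" "N \<in> null_sets M"
  shows "N \<in> sets (aug_filtration M W t)"
  unfolding sets_aug_filtration[OF assms(1)] using assms(2) by (intro sigma_sets.Basic) auto

lemma adapted_aug_filtration:
  assumes "brownian_motion M W" "0 \<le> t"
  shows "W t \<in> borel_measurable (aug_filtration M W t)"
proof (rule measurableI)
  fix B :: "real set" assume "B \<in> sets borel"
  then have "W t -` B \<inter> space M \<in> (\<Union>s\<in>{0..t}. {W s -` B \<inter> space M | B. B \<in> sets borel})"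
    using assms(2) by (intro UN_I[of t]) auto
  then show "W t -` B \<inter> space (aug_filtration M W t) \<in> sets (aug_filtration M W t)"
    unfolding sets_aug_filtration[OF assms(1)] space_aug_filtration
    by (intro sigma_sets.Basic UnI1)
qed simp

lemma tilted_nn_integral:
  assumes bm: "brownian_motion M W" and Q: "tilted_measure T \<sigma>\<^sub>C M W Q" and t: "t \<in> {0..T}"
    and F: "F \<in> borel_measurable (aug_filtration M W t)"
  shows "(\<integral>\<^sup>+\<omega>. F \<omega> \<partial>Q) =
    (\<integral>\<^sup>+\<omega>. ennreal (exp (- (1/2) * \<sigma>\<^sub>C\<^sup>2 * t + \<sigma>\<^sub>C * W t \<omega>)) * F \<omega> \<partial>M)"
proof -
  let ?F = "aug_filtration M W t"
  let ?d = "\<lambda>\<omega>. ennreal (exp (- (1/2) * \<sigma>\<^sub>C\<^sup>2 * t + \<sigma>\<^sub>C * W t \<omega>))"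
  have sub: "subalgebra M ?F" using bm by (rule subalgebra_aug_filtration)
  have sets_eq: "sets Q = sets M" using Q by (simp add: tilted_measure_def)
  have subQ: "subalgebra Q ?F"
    using sub sets_eq sets_eq_imp_space_eq[OF sets_eq] by (simp add: subalgebra_def)
  have [measurable]: "W t \<in> borel_measurable ?F"
    using adapted_aug_filtration[OF bm] t by simp
  have d: "?d \<in> borel_measurable ?F" by measurable
  have "(\<integral>\<^sup>+\<omega>. F \<omega> \<partial>Q) = (\<integral>\<^sup>+\<omega>. F \<omega> \<partial>restr_to_subalg Q ?F)"
    using nn_integral_subalgebra2[OF subQ F] by simp
  also have "restr_to_subalg Q ?F = density (restr_to_subalg M ?F) ?d"
    using Q t by (simp add: tilted_measure_def)
  also have "(\<integral>\<^sup>+\<omega>. F \<omega> \<partial>\<dots>) = (\<integral>\<^sup>+\<omega>. ?d \<omega> * F \<omega> \<partial>restr_to_subalg M ?F)"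
    by (intro nn_integral_density measurable_in_subalg[OF sub] d F)
  also have "\<dots> = (\<integral>\<^sup>+\<omega>. ?d \<omega> * F \<omega> \<partial>M)"
    by (intro nn_integral_subalgebra2[OF sub] borel_measurable_times_ennreal d F)
  finally show ?thesis .
qed

text \<open>
  At time \<open>0\<close> the density is almost surely \<open>1\<close>, and the \<open>\<sigma>\<close>-algebra of that time already contains
  the whole space and all null sets.
\<close>

lemma tilted_prob_space:
  assumes bm: "brownian_motion M W" and Q: "tilted_measure T \<sigma>\<^sub>C M W Q" and T: "0 \<le> T"
  shows "prob_space Q"
proof
  interpret brownian_motion M W by fact
  have "emeasure Q (space Q) = (\<integral>\<^sup>+\<omega>. 1 \<partial>Q)" by simp
  also have "\<dots> = (\<integral>\<^sup>+\<omega>. ennreal (exp (- (1/2) * \<sigma>\<^sub>C\<^sup>2 * 0 + \<sigma>\<^sub>C * W 0 \<omega>)) * 1 \<partial>M)"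
    by (rule tilted_nn_integral[OF bm Q]) (use T in auto)
  also have "\<dots> = (\<integral>\<^sup>+\<omega>. 1 \<partial>M)"
    using W_zero by (intro nn_integral_cong_AE) (auto elim: eventually_mono)
  finally show "emeasure Q (space Q) = 1" by (simp add: emeasure_space_1)
qed

lemma tilted_null_sets:
  assumes bm: "brownian_motion M W" and Q: "tilted_measure T \<sigma>\<^sub>C M W Q" and T: "0 \<le> T"
    and N: "N \<in> null_sets M"
  shows "N \<in> null_sets Q"
proof (rule null_setsI)
  show NQ: "N \<in> sets Q" using N Q by (auto simp: tilted_measure_def)
  have "emeasure Q N = (\<integral>\<^sup>+\<omega>. indicator N \<omega> \<partial>Q)" using NQ by simp
  also have "\<dots> = (\<integral>\<^sup>+\<omega>. ennreal (exp (- (1/2) * \<sigma>\<^sub>C\<^sup>2 * 0 + \<sigma>\<^sub>C * W 0 \<omega>)) * indicator N \<omega> \<partial>M)"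
    using T null_sets_aug_filtration[OF bm N]
    by (intro tilted_nn_integral[OF bm Q] borel_measurable_indicator) auto
  also have "\<dots> = 0" by (rule nn_integral_null_set[OF N])
  finally show "emeasure Q N = 0" .
qed

text \<open>
  The density at time \<open>t\<close> contains the factor \<open>exp (\<sigma>\<^sub>C W\<^sub>t)\<close>, which is exactly what the inverse of the
  process cancels: the product is deterministic.
\<close>

lemma C0_process_inverse_moment:
  assumes bm: "brownian_motion M W" and Q: "tilted_measure T \<sigma>\<^sub>C M W Q" and t: "t \<in> {0..T}"
  shows "(\<integral>\<^sup>+\<omega>. ennreal (1 / C0_process \<mu>\<^sub>C \<sigma>\<^sub>C W t \<omega>) \<partial>Q) = ennreal (exp (\<mu>\<^sub>C * t))"
proof -
  interpret brownian_motion M W by fact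
  have [measurable]: "W t \<in> borel_measurable (aug_filtration M W t)"
    using adapted_aug_filtration[OF bm] t by simp
  have "(\<integral>\<^sup>+\<omega>. ennreal (1 / C0_process \<mu>\<^sub>C \<sigma>\<^sub>C W t \<omega>) \<partial>Q) =
    (\<integral>\<^sup>+\<omega>. ennreal (exp (- (1/2) * \<sigma>\<^sub>C\<^sup>2 * t + \<sigma>\<^sub>C * W t \<omega>)) * ennreal (1 / C0_process \<mu>\<^sub>C \<sigma>\<^sub>C W t \<omega>) \<partial>M)"
    by (rule tilted_nn_integral[OF bm Q t]) (simp add: C0_process_def tilted_bm_def)
  also have "\<dots> = (\<integral>\<^sup>+\<omega>. ennreal (exp (\<mu>\<^sub>C * t)) \<partial>M)"
  proof (rule nn_integral_cong)
    fix \<omega>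
    have "exp (- (1/2) * \<sigma>\<^sub>C\<^sup>2 * t + \<sigma>\<^sub>C * W t \<omega>) * (1 / C0_process \<mu>\<^sub>C \<sigma>\<^sub>C W t \<omega>) = exp (\<mu>\<^sub>C * t)"
      unfolding C0_process_def tilted_bm_def
      by (simp add: exp_diff[symmetric]) (simp add: algebra_simps power2_eq_square)
    then show "ennreal (exp (- (1/2) * \<sigma>\<^sub>C\<^sup>2 * t + \<sigma>\<^sub>C * W t \<omega>)) * ennreal (1 / C0_process \<mu>\<^sub>C \<sigma>\<^sub>C W t \<omega>)
      = ennreal (exp (\<mu>\<^sub>C * t))"
      by (simp add: ennreal_mult'[symmetric])
  qed
  also have "\<dots> = ennreal (exp (\<mu>\<^sub>C * t))" by (simp add: emeasure_space_1)
  finally show ?thesis .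
qed

lemma const_in_stopping_times:
  assumes "0 \<le> c" "c \<le> h"
  shows "(\<lambda>_. c) \<in> stopping_times M W h"
  using assms by (auto simp: stopping_times_def stopping_time_def)

lemma stopping_times_measurable:
  assumes bm: "brownian_motion M W" and \<tau>: "\<tau> \<in> stopping_times M W h"
  shows "\<tau> \<in> borel_measurable M"
proof (rule borel_measurableI_le)
  fix s
  have "{\<omega> \<in> space (aug_filtration M W s). \<tau> \<omega> \<le> s} \<in> sets (aug_filtration M W s)"
    using \<tau> by (auto simp: stopping_times_def stopping_time_def pred_def)
  then show "{\<omega> \<in> space M. \<tau> \<omega> \<le> s} \<in> sets M"
    using subalgebra_aug_filtration[OF bm] by (auto simp: subalgebra_def)
qed

section \<open>The thresholds\<close>

theorem proposition3p8:
  fixes M Q :: "'a measure" and W :: "real \<Rightarrow> 'a \<Rightarrow> real"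
    and T \<mu>\<^sub>C \<sigma>\<^sub>C f\<^sub>C \<mu>\<^sub>F c\<^sub>p c\<^sub>m G\<^sub>0 :: real
    and R Rc Rcc G Gc :: "real \<Rightarrow> real"
    and v :: "real \<Rightarrow> real \<Rightarrow> real"
  assumes "T > 0" "\<mu>\<^sub>C > 0" "\<sigma>\<^sub>C > 0" "f\<^sub>C > 0" "\<mu>\<^sub>F > 0" "c\<^sub>m > 0" "c\<^sub>p > c\<^sub>m"
    and "complete_measure M" and "brownian_motion M W"
    and "tilted_measure T \<sigma>\<^sub>C M W Q"
    and "R \<in> borel_measurable (restrict_space borel {0..})"
    and "\<forall>C\<ge>0. R C \<ge> 0" and "mono_on {0..} R"
    and "strictly_concave_on {0..} R" and "R 0 = 0"
    and "\<forall>C>0. (R has_real_derivative Rc C) (at C)"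
    and "\<forall>C>0. (Rc has_real_derivative Rcc C) (at C)"
    and "continuous_on {0<..} Rcc"
    and "filterlim Rc at_top (at_right 0)" and "(Rc \<longlongrightarrow> 0) at_top"
    and "G\<^sub>0 \<ge> 0" and "\<forall>C\<ge>0. G C = G\<^sub>0 + c\<^sub>m / f\<^sub>C * C"
    and "\<forall>C>0. (G has_real_derivative Gc C) (at C)"
    and "v = game_value M W Q T f\<^sub>C c\<^sub>p c\<^sub>m (\<mu>\<^sub>C + \<mu>\<^sub>F) (C0_process \<mu>\<^sub>C \<sigma>\<^sub>C W) Rc Gc"
  shows "\<forall>t\<in>{0..<T}. \<exists>y\<^sub>p y\<^sub>m :: ereal.
    0 \<le> y\<^sub>p \<and> y\<^sub>p < y\<^sub>m \<and> y\<^sub>m \<le> \<infinity> \<and>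
    continuation_set v f\<^sub>C c\<^sub>p c\<^sub>m t = {y. y\<^sub>p < ereal y \<and> ereal y < y\<^sub>m} \<and>
    stopping_set v f\<^sub>C c\<^sub>p t = {y. 0 < y \<and> ereal y \<le> y\<^sub>p} \<and>
    stopping_set v f\<^sub>C c\<^sub>m t = {y. 0 < y \<and> y\<^sub>m \<le> ereal y}"
proof
  fix t assume t: "t \<in> {0..<T}"
  interpret brownian_motion M W by fact
  let ?X = "C0_process \<mu>\<^sub>C \<sigma>\<^sub>C W"
  define h where "h = T - t"
  have h: "0 < h" "h \<le> T" using t by (auto simp: h_def)
  have T: "0 \<le> T" using \<open>T > 0\<close> by simp
  have sets_Q: "sets Q = sets M" using assms(10) by (simp add: tilted_measure_def)
  have space_Q: "space Q = space M" using sets_Q by (rule sets_eq_imp_space_eq)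

  have conc: "concave_on {0..} R"
    unfolding concave_on_def
  proof (rule convex_onI)
    fix u x y :: real assume u: "0 < u" "u < 1" and xy: "x \<in> {0..}" "y \<in> {0..}"
    have "(1 - u) * R x + u * R y \<le> R ((1 - u) * x + u * y)"
    proof (cases "x = y")
      case True
      have "(1 - u) * x + u * x = x" by (simp add: algebra_simps)
      with True show ?thesis by (simp add: algebra_simps)
    next
      case False
      then show ?thesis using assms(14) u xy unfolding strictly_concave_on_def by (simp add: less_imp_le)
    qed
    then show "- R ((1 - u) *\<^sub>R x + u *\<^sub>R y) \<le> (1 - u) * - R x + u * - R y" by simp
  qed simp
  have der: "(R has_real_derivative Rc C) (at C)" if "0 < C" for C using assms(16) that by blast
  note anti = concave_marginal_antitone[OF conc \<open>R 0 = 0\<close> der]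
  have Rc_nonneg: "0 \<le> Rc x" if x: "0 < x" for x
  proof (rule tendsto_upperbound[OF assms(20)])
    show "\<forall>\<^sub>F z in at_top. Rc z \<le> Rc x"
      using eventually_ge_at_top[of x] by eventually_elim (use anti x in auto)
  qed simp
  \<comment> \<open>For \<open>x \<ge> 1\<close> by antitonicity, for \<open>x < 1\<close> because \<open>R x / x \<le> R 1 / x\<close>.\<close>
  have Rc_growth: "Rc x \<le> Rc 1 + R 1 / x" if x: "0 < x" for x
  proof (cases "1 \<le> x")
    case True
    then show ?thesis using anti[of 1 x] assms(12) by (simp add: add_increasing2)
  next
    case False
    have "Rc x \<le> R x / x" using concave_marginal_le_average[OF conc \<open>R 0 = 0\<close> der x] .
    also have "\<dots> \<le> R 1 / x"
      using False x assms(13) by (intro divide_right_mono) (auto simp: mono_on_def)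
    finally show ?thesis using Rc_nonneg[of 1] by simp
  qed
  have Rc_continuous: "continuous_on {0<..} Rc"
    using assms(17) by (intro continuous_at_imp_continuous_on ballI) (auto intro: DERIV_isCont)

  obtain N where N: "N \<in> null_sets M" "{\<omega> \<in> space M. \<not> continuous_on {0..} (\<lambda>s. W s \<omega>)} \<subseteq> N"
    using continuous_paths by (auto simp: eventually_ae_filter)

  interpret game: stopping_game Q ?X N "stopping_times M W h" h "\<mu>\<^sub>C + \<mu>\<^sub>F" f\<^sub>C c\<^sub>p c\<^sub>m
      "exp (\<mu>\<^sub>C * T)" "Rc 1" "R 1" Rc
  proof (intro stopping_game.intro stopping_game_axioms.intro)
    show "prob_space Q" using tilted_prob_space[OF assms(9,10) T] .
    show "0 < ?X s \<omega>" for s \<omega> by (simp add: C0_process_def)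
    show "?X s \<in> borel_measurable Q" if "0 \<le> s" for s
    proof -
      have [measurable]: "W s \<in> borel_measurable Q"
        using random_variable_W[OF that] by (simp cong: measurable_cong_sets add: sets_Q)
      show ?thesis unfolding C0_process_def tilted_bm_def by measurable
    qed
    show "N \<in> null_sets Q" using tilted_null_sets[OF assms(9,10) T N(1)] .
    show "A \<in> sets Q" if "A \<subseteq> N" for A
      using complete_measure.complete[OF assms(8) that N(1)] sets_Q by simp
    show "continuous_on {0..} (\<lambda>s. ?X s \<omega>)" if "\<omega> \<in> space Q - N" for \<omega>
    proof -
      have "continuous_on {0..} (\<lambda>s. W s \<omega>)" using that N(2) space_Q by auto
      then show ?thesis unfolding C0_process_def tilted_bm_def by (intro continuous_intros)
    qed
    show "(\<integral>\<^sup>+\<omega>. ennreal (1 / ?X s \<omega>) \<partial>Q) \<le> ennreal (exp (\<mu>\<^sub>C * T))" if "0 \<le> s" "s \<le> h" for s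
      using C0_process_inverse_moment[OF assms(9,10), of s \<mu>\<^sub>C] that h assms(2)
      by (simp add: ennreal_leI)
    show "\<tau> \<in> borel_measurable Q" if "\<tau> \<in> stopping_times M W h" for \<tau>
      using stopping_times_measurable[OF assms(9) that] by (simp cong: measurable_cong_sets add: sets_Q)
    show "0 \<le> \<tau> \<omega> \<and> \<tau> \<omega> \<le> h" if "\<tau> \<in> stopping_times M W h" "\<omega> \<in> space Q" for \<tau> \<omega>
      using that space_Q by (simp add: stopping_times_def)
    show "(\<lambda>_. 0) \<in> stopping_times M W h" "(\<lambda>_. h) \<in> stopping_times M W h"
      using h by (auto intro!: const_in_stopping_times)
    show "0 \<le> R 1" using assms(12) by simp
  qed (use assms h Rc_continuous anti Rc_nonneg Rc_growth in auto)

  have Gc: "Gc C = c\<^sub>m / f\<^sub>C" if C: "0 < C" for C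
  proof (rule DERIV_unique)
    show "(G has_real_derivative Gc C) (at C)" using assms(23) C by blast
    have "((\<lambda>C. G\<^sub>0 + c\<^sub>m / f\<^sub>C * C) has_real_derivative c\<^sub>m / f\<^sub>C) (at C)"
      using assms(4) by (auto intro!: derivative_eq_intros)
    then show "(G has_real_derivative c\<^sub>m / f\<^sub>C) (at C)"
      by (rule has_field_derivative_transform_within_open[where S="{0<..}"]) (use assms(22) C in auto)
  qed
  have v: "v t y = game.val y" if y: "0 < y" for y
  proof -
    have "game_payoff Q T f\<^sub>C c\<^sub>p c\<^sub>m (\<mu>\<^sub>C + \<mu>\<^sub>F) ?X Rc Gc t y \<sigma> \<tau> = game.payoff y \<sigma> \<tau>" for \<sigma> \<tau>
      using Gc y game.X_pos
      by (simp add: game_payoff_def game.payoff_def game.payment_def game.accumulated_def h_def[symmetric])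
    then show ?thesis
      by (simp add: assms(24) game_value_def game.val_def inf_sup_def h_def[symmetric])
  qed
  have a_less_b: "c\<^sub>m / f\<^sub>C < c\<^sub>p / f\<^sub>C" using assms(4,7) by (simp add: divide_strict_right_mono)
  have sets_eq: "continuation_set v f\<^sub>C c\<^sub>p c\<^sub>m t = {y\<in>{0<..}. c\<^sub>m / f\<^sub>C < game.val y \<and> game.val y < c\<^sub>p / f\<^sub>C}"
    "stopping_set v f\<^sub>C c t = {y\<in>{0<..}. game.val y = c / f\<^sub>C}" for c
    by (auto simp: continuation_set_def stopping_set_def v)
  show "\<exists>y\<^sub>p y\<^sub>m :: ereal. 0 \<le> y\<^sub>p \<and> y\<^sub>p < y\<^sub>m \<and> y\<^sub>m \<le> \<infinity> \<and>
    continuation_set v f\<^sub>C c\<^sub>p c\<^sub>m t = {y. y\<^sub>p < ereal y \<and> ereal y < y\<^sub>m} \<and>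
    stopping_set v f\<^sub>C c\<^sub>p t = {y. 0 < y \<and> ereal y \<le> y\<^sub>p} \<and>
    stopping_set v f\<^sub>C c\<^sub>m t = {y. 0 < y \<and> y\<^sub>m \<le> ereal y}"
    unfolding sets_eq
    by (rule antitone_continuous_thresholds[OF a_less_b game.val_continuous game.val_antitone
          game.val_lower game.val_upper game.val_not_lower game.val_not_upper])
qed

end
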